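(* Let $K\subset\mathbb{R}^3$ be a closed convex body whose boundary is parametrized by a $C^2$ regular parametrization $\boldsymbol\sigma:U\to\partial K$ ($U\subset\mathbb{R}^2$ open) with unit normal $\mathbf{n}$ pointing into $K$, with Weingarten matrix $W(u,v)$ and frame matrix $\Sigma(u,v)$. Let $c(t)$ be a trajectory in $\Omega=\mathbb{R}^3\setminus K$ defined on an open time interval. If $W$ is a Lipschitz function of $(u,v)$ and $c$ is continuously differentiable, then the differential equation $$\begin{pmatrix}\dot u\\ \dot v\\ \dot r\end{pmatrix}=\begin{pmatrix}(I-rW(u,v))^{-1}&0\\ 0&-1\end{pmatrix}\,\Sigma(u,v)^{-1}\,\dot c(t)$$ in the unknowns $(u,v,r)\in U\times(0,\infty)$ has local existence and uniqueness of solutions: for every initial time $t_0$ in the interval and every initial condition $(u(t_0),v(t_0),r(t_0))\in U\times(0,\infty)$ there is, on some open interval around $t_0$, a unique solution.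
   Context: A closed convex body is a closed convex set with nonempty interior. Regular means that $\boldsymbol\sigma_u=\partial_u\boldsymbol\sigma$ and $\boldsymbol\sigma_v=\partial_v\boldsymbol\sigma$ are linearly independent at every point. The orientation is such that $\mathbf{n}=\dfrac{\boldsymbol\sigma_u\times\boldsymbol\sigma_v}{|\boldsymbol\sigma_u\times\boldsymbol\sigma_v|}$ points into $K$. $\Sigma(u,v)$ is the (invertible) $3\times3$ matrix with columns $\boldsymbol\sigma_u,\boldsymbol\sigma_v,\mathbf{n}$, in this order. The Weingarten matrix $W=\begin{pmatrix}w_{11}&w_{12}\\ w_{21}&w_{22}\end{pmatrix}$ is defined by $\partial_u\mathbf{n}=w_{11}\boldsymbol\sigma_u+w_{21}\boldsymbol\sigma_v$ and $\partial_v\mathbf{n}=w_{12}\boldsymbol\sigma_u+w_{22}\boldsymbol\sigma_v$. Because $K$ is convex and $\mathbf{n}$ points into $K$, the eigenvalues of $-W$ (the principal curvatures) are nonnegative, so $I-rW$ is invertible for $r>0$. $I$ is the $2\times2$ identity matrix, and the $3\times 3$ matrix displayed is block diagonal. *)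

theory Defs
  imports "HOL-Analysis.Analysis"
begin

definition partial_u :: "(real \<times> real \<Rightarrow> 'a::real_normed_vector) \<Rightarrow> real \<times> real \<Rightarrow> 'a" where
  "partial_u f p = vector_derivative (\<lambda>s. f (s, snd p)) (at (fst p))"

definition partial_v :: "(real \<times> real \<Rightarrow> 'a::real_normed_vector) \<Rightarrow> real \<times> real \<Rightarrow> 'a" where
  "partial_v f p = vector_derivative (\<lambda>s. f (fst p, s)) (at (snd p))"

definition C1_on :: "(real \<times> real) set \<Rightarrow> (real \<times> real \<Rightarrow> 'a::real_normed_vector) \<Rightarrow> bool" where
  "C1_on U f \<longleftrightarrow>
     (\<forall>p\<in>U. (\<lambda>s. f (s, snd p)) differentiable (at (fst p))
          \<and> (\<lambda>s. f (fst p, s)) differentiable (at (snd p)))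
     \<and> continuous_on U (partial_u f) \<and> continuous_on U (partial_v f)"

definition C2_on :: "(real \<times> real) set \<Rightarrow> (real \<times> real \<Rightarrow> 'a::real_normed_vector) \<Rightarrow> bool" where
  "C2_on U f \<longleftrightarrow> C1_on U f \<and> C1_on U (partial_u f) \<and> C1_on U (partial_v f)"

text \<open>The inequality matters: if the two partial derivatives coincide, the set of both is a
  singleton and may be independent as a set.\<close>

definition regular_on :: "(real \<times> real) set \<Rightarrow> (real \<times> real \<Rightarrow> real^3) \<Rightarrow> bool" where
  "regular_on U \<sigma> \<longleftrightarrow>
     (\<forall>p\<in>U. partial_u \<sigma> p \<noteq> partial_v \<sigma> p \<and> independent {partial_u \<sigma> p, partial_v \<sigma> p})"

definition unit_normal :: "(real \<times> real \<Rightarrow> real^3) \<Rightarrow> real \<times> real \<Rightarrow> real^3" where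
  "unit_normal \<sigma> p =
     cross3 (partial_u \<sigma> p) (partial_v \<sigma> p) /\<^sub>R norm (cross3 (partial_u \<sigma> p) (partial_v \<sigma> p))"

definition points_into :: "'a::real_normed_vector set \<Rightarrow> 'a \<Rightarrow> 'a \<Rightarrow> bool" where
  "points_into K x v \<longleftrightarrow> (\<exists>\<epsilon>>0. \<forall>s. 0 < s \<and> s < \<epsilon> \<longrightarrow> x + s *\<^sub>R v \<in> interior K)"

text \<open>A matrix is a vector of rows, so \<open>W $ i $ j\<close> is the entry in row \<open>i\<close> and column \<open>j\<close>, and
  the transpose turns the listed vectors into columns.\<close>

definition weingarten :: "(real \<times> real \<Rightarrow> real^3) \<Rightarrow> real \<times> real \<Rightarrow> real^2^2" where
  "weingarten \<sigma> p = (THE W.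
     partial_u (unit_normal \<sigma>) p = (W $ 1 $ 1) *\<^sub>R partial_u \<sigma> p + (W $ 2 $ 1) *\<^sub>R partial_v \<sigma> p \<and>
     partial_v (unit_normal \<sigma>) p = (W $ 1 $ 2) *\<^sub>R partial_u \<sigma> p + (W $ 2 $ 2) *\<^sub>R partial_v \<sigma> p)"

definition frame_matrix :: "(real \<times> real \<Rightarrow> real^3) \<Rightarrow> real \<times> real \<Rightarrow> real^3^3" where
  "frame_matrix \<sigma> p = transpose (vector [partial_u \<sigma> p, partial_v \<sigma> p, unit_normal \<sigma> p])"

definition block_diag :: "real^2^2 \<Rightarrow> real \<Rightarrow> real^3^3" where
  "block_diag A b = vector
     [vector [A $ 1 $ 1, A $ 1 $ 2, 0],
      vector [A $ 2 $ 1, A $ 2 $ 2, 0],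
      vector [0,         0,         b]]"

text \<open>The unknowns \<open>(u, v, r)\<close> are the three components of a vector \<open>y\<close>.\<close>

definition state_space :: "(real \<times> real) set \<Rightarrow> (real^3) set" where
  "state_space U = {y. (y $ 1, y $ 2) \<in> U \<and> y $ 3 > 0}"

definition ode_rhs ::
    "(real \<times> real \<Rightarrow> real^3) \<Rightarrow> (real \<Rightarrow> real^3) \<Rightarrow> real \<Rightarrow> real^3 \<Rightarrow> real^3" where
  "ode_rhs \<sigma> c t y =
     (block_diag (matrix_inv (mat 1 - (y $ 3) *\<^sub>R weingarten \<sigma> (y $ 1, y $ 2))) (- 1)
        ** matrix_inv (frame_matrix \<sigma> (y $ 1, y $ 2)))
     *v vector_derivative c (at t)"

definition solves_on ::
    "(real \<times> real) set \<Rightarrow> (real \<times> real \<Rightarrow> real^3) \<Rightarrow> (real \<Rightarrow> real^3) \<Rightarrow> real set \<Rightarrow> (real \<Rightarrow> real^3) \<Rightarrow> bool"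
  where
  "solves_on U \<sigma> c T y \<longleftrightarrow>
     (\<forall>t\<in>T. y t \<in> state_space U \<and> (y has_vector_derivative ode_rhs \<sigma> c t (y t)) (at t))"

end

theory Submission
  imports Defs
begin

text \<open>
  The differential equation has the form \<open>y' = M(y) c'(t)\<close>, where \<open>M\<close> is built from the inverses of
  \<open>I - rW\<close> and of the frame matrix. Since \<open>c'\<close> is continuous, the Picard-Lindelof theorem applies as
  soon as \<open>M\<close> is Lipschitz near every state, and matrix inversion is Lipschitz near every
  invertible matrix (\<open>lipschitz_near_matrix_inv\<close>). Two things are therefore to be shown: both matrices
  are invertible, and their entries are Lipschitz near every point. The entries are no problem:
  \<open>W\<close> is Lipschitz by assumption, and the frame consists of \<open>\<sigma>\<^sub>u\<close> and \<open>\<sigma>\<^sub>v\<close>, which have continuous partial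
  derivatives, and of their normalised cross product. The frame is a basis because the surface is
  regular.

  The invertibility of \<open>I - rW\<close> is where convexity enters
  (\<open>invertible_one_minus_weingarten\<close>). The plane through \<open>\<sigma> p\<close> orthogonal to \<open>n p\<close> supports \<open>K\<close>
  (\<open>inward_normal_supports\<close>): some plane supports \<open>K\<close> there, and the surface, lying on one side of it,
  must be tangent to it. Adding the supporting inequalities at two points \<open>p\<close> and \<open>q\<close> gives
  \<open>(\<sigma> q - \<sigma> p) \<bullet> (n q - n p) \<le> 0\<close>, whence \<open>D\<sigma> x \<bullet> Dn x \<le> 0\<close> for every direction \<open>x\<close>. A vector \<open>x\<close> in the
  kernel of \<open>I - rW\<close> satisfies \<open>D\<sigma> x = r Dn x\<close>, so \<open>r \<bar>Dn x\<bar>\<^sup>2 \<le> 0\<close>; hence \<open>D\<sigma> x = 0\<close>, and \<open>x = 0\<close> by regularity.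
\<close>

section \<open>Local existence and uniqueness for ordinary differential equations\<close>

lemma vector_derivative_bound:
  fixes f :: "real \<Rightarrow> 'a::real_normed_vector"
  assumes "convex S" and d: "\<And>t. t \<in> S \<Longrightarrow> (f has_vector_derivative f' t) (at t within S)"
    and B: "\<And>t. t \<in> S \<Longrightarrow> norm (f' t) \<le> B" and "s \<in> S" "t \<in> S"
  shows "norm (f t - f s) \<le> B * \<bar>t - s\<bar>"
proof -
  have "norm (f t - f s) \<le> B * norm (t - s)"
  proof (rule differentiable_bound[OF \<open>convex S\<close>])
    fix x assume "x \<in> S"
    then show "(f has_derivative (\<lambda>h. h *\<^sub>R f' x)) (at x within S)"
      using d unfolding has_vector_derivative_def by blast
    show "onorm (\<lambda>h::real. h *\<^sub>R f' x) \<le> B"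
      using B[OF \<open>x \<in> S\<close>] by (intro onorm_le) (metis mult.commute mult_right_mono norm_ge_zero norm_scaleR real_norm_def)
  qed (use assms in auto)
  then show ?thesis by simp
qed

text \<open>The solution is the fixed point of the Picard operator \<open>\<phi> \<mapsto> x0 + \<integral> f s (\<phi> s) ds\<close> on the Banach space of
bounded continuous functions on the whole line. On a short interval this operator contracts with
factor \<open>L * (b - a)\<close>, by the mean value inequality.\<close>

lemma picard_lindelof_global_lipschitz:
  fixes f :: "real \<Rightarrow> 'a::banach \<Rightarrow> 'a"
  assumes t0: "a \<le> t0" "t0 \<le> b"
    and cont: "continuous_on ({a..b} \<times> UNIV) (\<lambda>(t, x). f t x)"
    and lip: "\<And>t. t \<in> {a..b} \<Longrightarrow> L-lipschitz_on UNIV (f t)"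
    and small: "L * (b - a) < 1"
  obtains y where "y t0 = x0"
    and "\<And>t. t \<in> {a..b} \<Longrightarrow> (y has_vector_derivative f t (y t)) (at t within {a..b})"
proof -
  have L: "0 \<le> L" using lipschitz_on_nonneg[OF lip[of t0]] t0 by auto
  define F where "F \<phi> t = integral {a..t} (\<lambda>s. f s (apply_bcontfun \<phi> s))" for \<phi> :: "real \<Rightarrow>\<^sub>C 'a" and t
  \<comment> \<open>Freezing time outside \<open>{a..b}\<close> makes the Picard operator produce bounded functions on the line;
    subtracting the value at \<open>t0\<close> turns the integral from \<open>a\<close> into the integral from \<open>t0\<close>, of either sign.\<close>
  define q where "q t = max a (min b t)" for t
  define G where "G \<phi> t = x0 + F \<phi> (q t) - F \<phi> t0" for \<phi> t
  define P where "P \<phi> = Bcontfun (G \<phi>)" for \<phi>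
  have q: "q t \<in> {a..b}" for t using t0 by (auto simp: q_def)
  have F': "(F \<phi> has_vector_derivative f t (\<phi> t)) (at t within {a..b})" if "t \<in> {a..b}" for \<phi> t
  proof -
    have "continuous_on {a..b} ((\<lambda>(t, x). f t x) \<circ> (\<lambda>s. (s, \<phi> s)))"
      by (intro continuous_on_compose continuous_intros continuous_on_subset[OF cont]) auto
    then have "continuous_on {a..b} (\<lambda>s. f s (\<phi> s))" by (simp add: o_def)
    from integral_has_vector_derivative[OF this that] show ?thesis by (simp add: F_def[abs_def])
  qed
  have Fcont: "continuous_on {a..b} (F \<phi>)" for \<phi>
    by (meson F' has_vector_derivative_continuous continuous_on_eq_continuous_within)
  have P: "apply_bcontfun (P \<phi>) = G \<phi>" for \<phi>
  proof -
    have "continuous_on UNIV (G \<phi>)"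
    proof -
      have "continuous_on UNIV (F \<phi> \<circ> q)"
        by (intro continuous_on_compose continuous_on_subset[OF Fcont])
           (use q in \<open>auto simp: q_def[abs_def] intro!: continuous_intros\<close>)
      then show ?thesis by (auto simp: G_def[abs_def] o_def intro!: continuous_intros)
    qed
    moreover have "bounded (range (G \<phi>))"
    proof (rule bounded_subset)
      show "bounded ((\<lambda>t. x0 + F \<phi> t - F \<phi> t0) ` {a..b})"
        by (intro compact_imp_bounded compact_continuous_image continuous_intros Fcont) auto
      show "range (G \<phi>) \<subseteq> (\<lambda>t. x0 + F \<phi> t - F \<phi> t0) ` {a..b}"
        using q by (auto simp: G_def)
    qed
    ultimately show ?thesis unfolding P_def by (intro Bcontfun_inverse) (simp add: bcontfun_def)
  qed
  have "dist (P \<phi>) (P \<psi>) \<le> L * (b - a) * dist \<phi> \<psi>" for \<phi> \<psi>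
  proof (rule dist_bound)
    fix t
    have "norm ((F \<phi> (q t) - F \<psi> (q t)) - (F \<phi> t0 - F \<psi> t0)) \<le> (L * dist \<phi> \<psi>) * \<bar>q t - t0\<bar>"
    proof (rule vector_derivative_bound[where S = "{a..b}"])
      fix s assume s: "s \<in> {a..b}"
      show "((\<lambda>t. F \<phi> t - F \<psi> t) has_vector_derivative f s (\<phi> s) - f s (\<psi> s)) (at s within {a..b})"
        by (intro has_vector_derivative_diff F' s)
      have "norm (f s (\<phi> s) - f s (\<psi> s)) \<le> L * dist (\<phi> s) (\<psi> s)"
        using lipschitz_onD[OF lip[OF s]] by (simp add: dist_norm)
      also have "\<dots> \<le> L * dist \<phi> \<psi>" by (intro mult_left_mono dist_bounded L)
      finally show "norm (f s (\<phi> s) - f s (\<psi> s)) \<le> L * dist \<phi> \<psi>" .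
    qed (use q t0 in auto)
    also have "\<dots> \<le> (L * dist \<phi> \<psi>) * (b - a)"
      using q[of t] t0 by (intro mult_left_mono mult_nonneg_nonneg L) auto
    finally show "dist (P \<phi> t) (P \<psi> t) \<le> L * (b - a) * dist \<phi> \<psi>"
      by (simp add: P G_def dist_norm algebra_simps)
  qed
  then have "\<exists>!\<phi>. P \<phi> = \<phi>"
    using L t0 small by (intro banach_fix_type[of "L * (b - a)"]) auto
  then obtain \<phi> where \<phi>: "P \<phi> = \<phi>" by blast
  then have eq: "\<phi> t = x0 + F \<phi> (q t) - F \<phi> t0" for t using P[of \<phi>] by (metis G_def)
  show ?thesis
  proof
    show "\<phi> t0 = x0" using t0 by (simp add: eq q_def)
    fix t assume t: "t \<in> {a..b}"
    have "((\<lambda>t. x0 + F \<phi> t - F \<phi> t0) has_vector_derivative f t (\<phi> t)) (at t within {a..b})"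
      using F'[OF t] by (auto intro!: derivative_eq_intros)
    then show "(\<phi> has_vector_derivative f t (\<phi> t)) (at t within {a..b})"
      by (rule has_vector_derivative_transform[rotated 2]) (use t in \<open>auto simp: eq q_def\<close>)
  qed
qed

text \<open>The right-hand side becomes globally Lipschitz when it is precomposed with the nearest-point
projection onto the ball, which does not increase distances. It is bounded by some \<open>B\<close>, so a solution
travels at most \<open>B * \<delta>\<close>, which is at most \<open>\<rho>\<close>: it stays in the ball, where the projection is the identity.\<close>

lemma picard_lindelof_cball:
  fixes f :: "real \<Rightarrow> 'a::euclidean_space \<Rightarrow> 'a"
  assumes "0 < \<tau>" "0 < \<rho>"
    and cont: "continuous_on ({t0 - \<tau>..t0 + \<tau>} \<times> cball x0 \<rho>) (\<lambda>(t, x). f t x)"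
    and lip: "\<And>t. t \<in> {t0 - \<tau>..t0 + \<tau>} \<Longrightarrow> L-lipschitz_on (cball x0 \<rho>) (f t)"
  obtains \<delta> y where "0 < \<delta>" "\<delta> \<le> \<tau>" "y t0 = x0"
    and "\<And>t. t \<in> {t0 - \<delta><..<t0 + \<delta>} \<Longrightarrow>
           y t \<in> cball x0 \<rho> \<and> (y has_vector_derivative f t (y t)) (at t)"
proof -
  let ?T = "{t0 - \<tau>..t0 + \<tau>}" and ?C = "cball x0 \<rho>"
  have L: "0 \<le> L" using lipschitz_on_nonneg[OF lip[of t0]] \<open>0 < \<tau>\<close> by auto
  have "bounded ((\<lambda>(t, x). f t x) ` (?T \<times> ?C))"
    by (intro compact_imp_bounded compact_continuous_image cont compact_Times) auto
  then obtain B where B: "0 < B" "\<And>t x. t \<in> ?T \<Longrightarrow> x \<in> ?C \<Longrightarrow> norm (f t x) \<le> B"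
    unfolding bounded_pos by auto
  \<comment> \<open>The second bound keeps the solution in the ball, the third makes \<open>L\<close> times the length of the interval
    less than \<open>1\<close>; \<open>L + 1\<close> replaces \<open>L\<close> because \<open>L\<close> may vanish.\<close>
  define \<delta> where "\<delta> = min \<tau> (min (\<rho> / B) (1 / (4 * (L + 1))))"
  have \<delta>: "0 < \<delta>" "\<delta> \<le> \<tau>" "\<delta> \<le> \<rho> / B" "\<delta> \<le> 1 / (4 * (L + 1))"
    using assms B L by (auto simp: \<delta>_def)
  have small: "L * ((t0 + \<delta>) - (t0 - \<delta>)) < 1"
  proof -
    have "L * (2 * \<delta>) \<le> L * (2 * (1 / (4 * (L + 1))))"
      using \<delta> L by (intro mult_left_mono) auto
    also have "\<dots> < 1" using L by (simp add: field_simps)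
    finally show ?thesis by simp
  qed
  define \<pi> where "\<pi> = closest_point ?C"
  have C: "closed ?C" "convex ?C" "?C \<noteq> {}" using \<open>0 < \<rho>\<close> by auto
  have \<pi>: "\<pi> x \<in> ?C" "dist (\<pi> x) (\<pi> z) \<le> dist x z" for x z
    unfolding \<pi>_def using closest_point_in_set[OF C(1,3)] closest_point_lipschitz[OF C(2,1,3)] by auto
  have \<pi>cont: "continuous_on S \<pi>" for S
    using \<pi>(2) by (intro lipschitz_on_continuous_on[where L = 1] lipschitz_onI) auto
  let ?I = "{t0 - \<delta>..t0 + \<delta>}"
  obtain y where y0: "y t0 = x0"
    and y: "\<And>t. t \<in> ?I \<Longrightarrow> (y has_vector_derivative f t (\<pi> (y t))) (at t within ?I)"
  proof (rule picard_lindelof_global_lipschitz[of "t0 - \<delta>" t0 "t0 + \<delta>" "\<lambda>t x. f t (\<pi> x)" L x0])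
    have "continuous_on (?I \<times> UNIV) ((\<lambda>(t, x). f t x) \<circ> (\<lambda>(t, x). (t, \<pi> x)))"
      using \<delta> \<pi> by (intro continuous_on_compose continuous_on_subset[OF cont])
        (auto simp: case_prod_unfold simp del: mem_cball
              intro!: continuous_intros continuous_on_compose2[OF \<pi>cont[of UNIV]])
    then show "continuous_on (?I \<times> UNIV) (\<lambda>(t, x). f t (\<pi> x))" by (simp add: o_def case_prod_unfold)
    fix t assume "t \<in> ?I"
    then have t: "t \<in> ?T" using \<delta> by auto
    show "L-lipschitz_on UNIV (\<lambda>x. f t (\<pi> x))"
    proof (rule lipschitz_onI)
      fix x z
      have "dist (f t (\<pi> x)) (f t (\<pi> z)) \<le> L * dist (\<pi> x) (\<pi> z)"
        using lipschitz_onD[OF lip[OF t]] \<pi> by blast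
      also have "\<dots> \<le> L * dist x z" by (intro mult_left_mono \<pi> L)
      finally show "dist (f t (\<pi> x)) (f t (\<pi> z)) \<le> L * dist x z" .
    qed (rule L)
  qed (use small \<delta> in auto)
  have inC: "y t \<in> ?C" if "t \<in> ?I" for t
  proof -
    have "norm (y t - y t0) \<le> B * \<bar>t - t0\<bar>"
      by (rule vector_derivative_bound[OF _ y]) (use \<delta> that \<pi> in \<open>auto intro!: B simp del: mem_cball\<close>)
    also have "\<dots> \<le> B * (\<rho> / B)" using that \<delta> B(1) by (intro mult_left_mono) auto
    finally show ?thesis using B(1) by (simp add: y0 dist_norm norm_minus_commute)
  qed
  show ?thesis
  proof
    show "0 < \<delta>" "\<delta> \<le> \<tau>" "y t0 = x0" by fact+
    fix t assume t: "t \<in> {t0 - \<delta><..<t0 + \<delta>}"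
    then have tI: "t \<in> ?I" by auto
    have "(y has_vector_derivative f t (y t)) (at t within ?I)"
      using y[OF tI] closest_point_self[OF inC[OF tI]] by (simp add: \<pi>_def)
    moreover have "at t within ?I = at t" using t by (intro at_within_Icc_at) auto
    ultimately show "y t \<in> ?C \<and> (y has_vector_derivative f t (y t)) (at t)" using inC[OF tI] by simp
  qed
qed

lemma picard_lindelof_exists:
  fixes f :: "real \<Rightarrow> 'a::euclidean_space \<Rightarrow> 'a"
  assumes "open J" "open X" "t0 \<in> J" "x0 \<in> X"
    and cont: "continuous_on (J \<times> X) (\<lambda>(t, x). f t x)"
    and lip: "local_lipschitz J X f"
  shows "\<exists>\<delta> y. 0 < \<delta> \<and> {t0 - \<delta><..<t0 + \<delta>} \<subseteq> J \<and> y t0 = x0 \<and>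
    (\<forall>t\<in>{t0 - \<delta><..<t0 + \<delta>}. y t \<in> X \<and> (y has_vector_derivative f t (y t)) (at t))"
proof -
  obtain u L where u: "0 < u" "\<And>s. s \<in> cball t0 u \<inter> J \<Longrightarrow> L-lipschitz_on (cball x0 u \<inter> X) (f s)"
    using local_lipschitzE[OF lip \<open>t0 \<in> J\<close> \<open>x0 \<in> X\<close>] by blast
  obtain e1 where e1: "0 < e1" "cball t0 e1 \<subseteq> J" using assms open_contains_cball by blast
  obtain e2 where e2: "0 < e2" "cball x0 e2 \<subseteq> X" using assms open_contains_cball by blast
  define \<tau> where "\<tau> = min u e1"
  define \<rho> where "\<rho> = min u e2"
  have \<tau>: "0 < \<tau>" "{t0 - \<tau>..t0 + \<tau>} \<subseteq> cball t0 u \<inter> J"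
    using u e1 unfolding cball_eq_atLeastAtMost[symmetric] by (auto simp: \<tau>_def)
  have \<rho>: "0 < \<rho>" "cball x0 \<rho> \<subseteq> cball x0 u \<inter> X" using u e2 by (auto simp: \<rho>_def)
  have "continuous_on ({t0 - \<tau>..t0 + \<tau>} \<times> cball x0 \<rho>) (\<lambda>(t, x). f t x)"
    by (rule continuous_on_subset[OF cont]) (use \<tau> \<rho> in blast)
  moreover have "L-lipschitz_on (cball x0 \<rho>) (f t)" if "t \<in> {t0 - \<tau>..t0 + \<tau>}" for t
    using lipschitz_on_subset[OF u(2) \<rho>(2)] that \<tau> by blast
  ultimately obtain \<delta> y where d: "0 < \<delta>" "\<delta> \<le> \<tau>" and y: "y t0 = x0"
    "\<And>t. t \<in> {t0 - \<delta><..<t0 + \<delta>} \<Longrightarrow> y t \<in> cball x0 \<rho> \<and> (y has_vector_derivative f t (y t)) (at t)"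
    using picard_lindelof_cball[OF \<tau>(1) \<rho>(1)] by metis
  have "{t0 - \<delta><..<t0 + \<delta>} \<subseteq> {t0 - \<tau>..t0 + \<tau>}" using d by auto
  then have "{t0 - \<delta><..<t0 + \<delta>} \<subseteq> J" using \<tau>(2) by blast
  then show ?thesis using d y \<rho>(2) by blast
qed

text \<open>The times at which two solutions agree form a closed subset of the connected set \<open>I\<close>; it is also open.
Indeed, let \<open>s\<close> be such a time and let \<open>r\<close> maximise the distance of the solutions over a
small interval of radius \<open>e\<close> about \<open>s\<close>. By the mean value inequality that distance is at most
\<open>L * e\<close> times itself, with \<open>L * e \<le> 1 / 2\<close>, hence zero. Working with the whole of \<open>X\<close> instead of a ball
around the initial value gives uniqueness among all solutions, however far they travel.\<close>

lemma ode_solution_unique: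
  fixes f :: "real \<Rightarrow> 'a::real_normed_vector \<Rightarrow> 'a"
  assumes lip: "local_lipschitz J X f" and I: "open I" "connected I" "I \<subseteq> J" "t0 \<in> I"
    and y: "\<And>t. t \<in> I \<Longrightarrow> y t \<in> X \<and> (y has_vector_derivative f t (y t)) (at t)"
    and z: "\<And>t. t \<in> I \<Longrightarrow> z t \<in> X \<and> (z has_vector_derivative f t (z t)) (at t)"
    and "y t0 = z t0" and "t \<in> I"
  shows "z t = y t"
proof -
  have cy: "continuous_on I y" and cz: "continuous_on I z"
    using y z by (auto intro!: continuous_at_imp_continuous_on has_vector_derivative_continuous)
  let ?S = "{t \<in> I. z t - y t = 0}"
  have "closedin (top_of_set I) ?S"
    by (intro continuous_closedin_preimage_constant continuous_intros cy cz)
  moreover have "openin (top_of_set I) ?S"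
  proof -
    have "\<exists>e>0. ball s e \<subseteq> ?S" if "s \<in> ?S" for s
    proof -
      have s: "s \<in> I" "z s = y s" "y s \<in> X" "s \<in> J" using that y I by auto
      obtain u L where u: "0 < u" "\<And>r. r \<in> cball s u \<inter> J \<Longrightarrow> L-lipschitz_on (cball (y s) u \<inter> X) (f r)"
        using local_lipschitzE[OF lip \<open>s \<in> J\<close> \<open>y s \<in> X\<close>] by blast
      have L: "0 \<le> L" using u(2)[of s] s u(1) lipschitz_on_nonneg by fastforce
      have near: "\<exists>d>0. ball s d \<subseteq> I \<inter> w -` ball (y s) u" if "continuous_on I w" "w s = y s" for w
      proof -
        have "open (I \<inter> w -` ball (y s) u)" using that I by (simp add: continuous_open_preimage)
        moreover have "s \<in> I \<inter> w -` ball (y s) u" using that s u by auto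
        ultimately show ?thesis by (meson openE)
      qed
      obtain d1 where d1: "0 < d1" "ball s d1 \<subseteq> I \<inter> y -` ball (y s) u" using near[OF cy] by auto
      obtain d2 where d2: "0 < d2" "ball s d2 \<subseteq> I \<inter> z -` ball (y s) u" using near[OF cz s(2)] by auto
      define k where "k = 1 / (2 * (L + 1))"
      define e where "e = min (min d1 d2) (min u k) / 2"
      have e: "0 < e" "e < d1" "e < d2" "e \<le> u" "L * e \<le> 1 / 2"
      proof -
        have *: "0 < min (min d1 d2) (min u k)" using d1 d2 u L by (auto simp: k_def)
        then show "0 < e" "e < d1" "e < d2" "e \<le> u" by (auto simp: e_def)
        have "e \<le> k" using * by (auto simp: e_def)
        then have "L * e \<le> L * k" using L by (intro mult_left_mono)
        also have "\<dots> \<le> 1 / 2" using L by (simp add: k_def field_simps)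
        finally show "L * e \<le> 1 / 2" .
      qed
      have sub: "cball s e \<subseteq> ball s d1" "cball s e \<subseteq> ball s d2" "cball s e \<subseteq> cball s u" using e by auto
      obtain r where r: "r \<in> cball s e" "\<And>r'. r' \<in> cball s e \<Longrightarrow> norm (z r' - y r') \<le> norm (z r - y r)"
      proof (rule continuous_attains_sup[THEN bexE])
        show "continuous_on (cball s e) (\<lambda>r. norm (z r - y r))"
          by (intro continuous_intros continuous_on_subset[OF cy] continuous_on_subset[OF cz])
             (use sub d1 in auto)
      qed (use e in auto)
      have "norm ((z r - y r) - (z s - y s)) \<le> (L * norm (z r - y r)) * \<bar>r - s\<bar>"
      proof (rule vector_derivative_bound[where S = "cball s e"])
        fix q assume q: "q \<in> cball s e"
        have qI: "q \<in> I" "y q \<in> ball (y s) u" "z q \<in> ball (y s) u"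
          using q sub(1,2) d1(2) d2(2) by blast+
        then have qu: "y q \<in> cball (y s) u \<inter> X" "z q \<in> cball (y s) u \<inter> X"
          using y z by auto
        have qJ: "q \<in> cball s u \<inter> J" using q sub(3) qI(1) I(3) by blast
        show "((\<lambda>r. z r - y r) has_vector_derivative f q (z q) - f q (y q)) (at q within cball s e)"
          using y[OF qI(1)] z[OF qI(1)]
          by (intro has_vector_derivative_at_within[OF has_vector_derivative_diff]) auto
        have "norm (f q (z q) - f q (y q)) \<le> L * norm (z q - y q)"
          using lipschitz_on_normD[OF u(2)[OF qJ] qu(2,1)] .
        also have "\<dots> \<le> L * norm (z r - y r)" using r(2)[OF q] L by (intro mult_left_mono)
        finally show "norm (f q (z q) - f q (y q)) \<le> L * norm (z r - y r)" .
      qed (use e r in auto)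
      also have "\<dots> \<le> (L * norm (z r - y r)) * e"
        using r(1) L by (intro mult_left_mono) (auto simp: dist_real_def)
      also have "\<dots> = (L * e) * norm (z r - y r)" by simp
      also have "\<dots> \<le> 1 / 2 * norm (z r - y r)" using e by (intro mult_right_mono) auto
      finally have "norm (z r - y r) = 0" using s by simp
      then have "ball s e \<subseteq> ?S" using r(2) sub d1 by fastforce
      then show ?thesis using e by blast
    qed
    then have "open ?S" unfolding open_contains_ball by blast
    then show ?thesis using I by (simp add: openin_open_eq)
  qed
  moreover have "t0 \<in> ?S" using assms by auto
  ultimately have "?S = I" using I(2) unfolding connected_clopen by blast
  then show ?thesis using \<open>t \<in> I\<close> by auto
qed

section \<open>Maps that are Lipschitz near a point\<close>

text \<open>The Lipschitz property on some neighbourhood passes to products and inverses of matrices, whose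
estimates rest on bounds that hold only locally.\<close>

definition lipschitz_near :: "'a::metric_space \<Rightarrow> ('a \<Rightarrow> 'b::metric_space) \<Rightarrow> bool" where
  "lipschitz_near x f \<longleftrightarrow> (\<exists>e>0. \<exists>L. L-lipschitz_on (ball x e) f)"

lemma lipschitz_nearI:
  assumes "open S" "x \<in> S" "L-lipschitz_on S f"
  shows "lipschitz_near x f"
proof -
  obtain e where "0 < e" "ball x e \<subseteq> S" using assms openE by blast
  then show ?thesis using lipschitz_on_subset[OF assms(3)] unfolding lipschitz_near_def by blast
qed

lemma lipschitz_nearE:
  assumes "lipschitz_near x f"
  obtains S L where "open S" "x \<in> S" "L-lipschitz_on S f"
  using assms unfolding lipschitz_near_def by (metis open_ball centre_in_ball)

lemma lipschitz_near_const: "lipschitz_near x (\<lambda>_. c)"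
  by (rule lipschitz_nearI[OF open_UNIV UNIV_I lipschitz_on_constant])

lemma (in bounded_linear) lipschitz_near: "lipschitz_near x f"
  using lipschitz_boundE[of UNIV] lipschitz_nearI[OF open_UNIV UNIV_I] by metis

lemma lipschitz_near_compose:
  assumes f: "lipschitz_near x f" and g: "lipschitz_near (f x) g"
  shows "lipschitz_near x (\<lambda>z. g (f z))"
proof -
  obtain S L where S: "open S" "x \<in> S" "L-lipschitz_on S f" using f by (rule lipschitz_nearE)
  obtain T M where T: "open T" "f x \<in> T" "M-lipschitz_on T g" using g by (rule lipschitz_nearE)
  have "open (S \<inter> f -` T)"
    using lipschitz_on_continuous_on[OF S(3)] S(1) T(1) by (rule continuous_open_preimage)
  moreover have "(M * L)-lipschitz_on (S \<inter> f -` T) (\<lambda>z. g (f z))"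
    by (rule lipschitz_on_compose2[OF lipschitz_on_subset[OF S(3)] lipschitz_on_subset[OF T(3)]]) auto
  ultimately show ?thesis using S T by (intro lipschitz_nearI) auto
qed

lemma lipschitz_near_diff:
  fixes f g :: "'a::metric_space \<Rightarrow> 'b::real_normed_vector"
  assumes f: "lipschitz_near x f" and g: "lipschitz_near x g"
  shows "lipschitz_near x (\<lambda>z. f z - g z)"
proof -
  obtain S L where S: "open S" "x \<in> S" "L-lipschitz_on S f" using f by (rule lipschitz_nearE)
  obtain T M where T: "open T" "x \<in> T" "M-lipschitz_on T g" using g by (rule lipschitz_nearE)
  have "(L + M)-lipschitz_on (S \<inter> T) (\<lambda>z. f z - g z)"
    by (intro lipschitz_on_diff lipschitz_on_subset[OF S(3)] lipschitz_on_subset[OF T(3)]) auto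
  then show ?thesis using S T by (intro lipschitz_nearI[of "S \<inter> T"]) auto
qed

lemma (in bounded_bilinear) lipschitz_near:
  fixes f :: "'d::metric_space \<Rightarrow> 'a" and g :: "'d \<Rightarrow> 'b"
  assumes f: "lipschitz_near x f" and g: "lipschitz_near x g"
  shows "lipschitz_near x (\<lambda>z. prod (f z) (g z))"
proof -
  obtain S L where S: "open S" "x \<in> S" "L-lipschitz_on S f" using f by (rule lipschitz_nearE)
  obtain T M where T: "open T" "x \<in> T" "M-lipschitz_on T g" using g by (rule lipschitz_nearE)
  obtain K where K: "0 \<le> K" "\<And>a b. norm (prod a b) \<le> norm a * norm b * K"
    using nonneg_bounded by blast
  define R where "R = S \<inter> T \<inter> ball x 1"
  define A where "A = norm (f x) + L"
  define B where "B = norm (g x) + M"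
  have nonneg: "0 \<le> L" "0 \<le> M" using S T lipschitz_on_nonneg by auto
  have A: "norm (f z) \<le> A" and B: "norm (g z) \<le> B" if "z \<in> R" for z
  proof -
    have z: "z \<in> S" "z \<in> T" "dist z x \<le> 1" using that by (auto simp: R_def dist_commute)
    have "norm (f z - f x) \<le> L * 1" "norm (g z - g x) \<le> M * 1"
      using order_trans[OF lipschitz_onD[OF S(3) z(1) S(2)] mult_left_mono[OF z(3) nonneg(1)]]
        order_trans[OF lipschitz_onD[OF T(3) z(2) T(2)] mult_left_mono[OF z(3) nonneg(2)]]
      by (auto simp: dist_norm)
    then show "norm (f z) \<le> A" "norm (g z) \<le> B"
      unfolding A_def B_def using norm_triangle_sub[of "f z" "f x"] norm_triangle_sub[of "g z" "g x"] by auto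
  qed
  have AB: "0 \<le> A" "0 \<le> B" using nonneg by (auto simp: A_def B_def)
  have "((L * B + A * M) * K)-lipschitz_on R (\<lambda>z. prod (f z) (g z))"
  proof (rule lipschitz_onI)
    fix z w assume zw: "z \<in> R" "w \<in> R"
    \<comment> \<open>The product rule for differences; one factor in each term is bounded on \<open>R\<close>.\<close>
    have "prod (f z) (g z) - prod (f w) (g w) = prod (f z - f w) (g z) + prod (f w) (g z - g w)"
      by (simp add: diff_left diff_right)
    then have "norm (prod (f z) (g z) - prod (f w) (g w))
        \<le> norm (f z - f w) * norm (g z) * K + norm (f w) * norm (g z - g w) * K"
      using norm_triangle_mono[OF K(2) K(2)] by metis
    also have "\<dots> \<le> (L * dist z w) * B * K + A * (M * dist z w) * K"
      using zw lipschitz_onD[OF S(3), of z w] lipschitz_onD[OF T(3), of z w]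
      by (intro add_mono mult_right_mono mult_mono A B K(1) AB mult_nonneg_nonneg nonneg)
         (auto simp: R_def dist_norm)
    finally show "dist (prod (f z) (g z)) (prod (f w) (g w)) \<le> (L * B + A * M) * K * dist z w"
      by (simp add: dist_norm algebra_simps)
  qed (use nonneg AB K in auto)
  then show ?thesis
    by (rule lipschitz_nearI[rotated 2]) (use S T in \<open>auto simp: R_def\<close>)
qed

lemma lipschitz_near_vecI:
  fixes f :: "'a::metric_space \<Rightarrow> 'b::real_normed_vector^'n"
  assumes "\<And>i. lipschitz_near x (\<lambda>z. f z $ i)"
  shows "lipschitz_near x f"
proof -
  have "\<forall>i. \<exists>S. \<exists>L. open S \<and> x \<in> S \<and> L-lipschitz_on S (\<lambda>z. f z $ i)"
    using assms lipschitz_nearE by metis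
  then obtain S L where S: "\<And>i. open (S i)" "\<And>i. x \<in> S i" "\<And>i. (L i)-lipschitz_on (S i) (\<lambda>z. f z $ i)"
    by metis
  have "(\<Sum>i\<in>UNIV. L i)-lipschitz_on (\<Inter>i. S i) f"
  proof (rule lipschitz_onI)
    fix z w assume zw: "z \<in> (\<Inter>i. S i)" "w \<in> (\<Inter>i. S i)"
    have "norm (f z - f w) \<le> (\<Sum>i\<in>UNIV. norm ((f z - f w) $ i))"
      unfolding norm_vec_def by (rule L2_set_le_sum) simp
    also have "\<dots> \<le> (\<Sum>i\<in>UNIV. L i * dist z w)"
      using zw lipschitz_onD[OF S(3)] by (intro sum_mono) (auto simp: dist_norm)
    finally show "dist (f z) (f w) \<le> (\<Sum>i\<in>UNIV. L i) * dist z w"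
      by (simp add: dist_norm sum_distrib_right)
  qed (intro sum_nonneg lipschitz_on_nonneg[OF S(3)])
  then show ?thesis using S by (intro lipschitz_nearI[of "\<Inter>i. S i"]) auto
qed

lemma lipschitz_near_nth:
  fixes f :: "'a::metric_space \<Rightarrow> 'b::real_normed_vector^'n"
  assumes "lipschitz_near x f"
  shows "lipschitz_near x (\<lambda>z. f z $ i)"
  by (rule lipschitz_near_compose[OF assms bounded_linear.lipschitz_near[OF bounded_linear_vec_nth]])

lemma lipschitz_near_imp_continuous_on:
  assumes "\<And>x. x \<in> X \<Longrightarrow> lipschitz_near x f"
  shows "continuous_on X f"
proof (rule continuous_at_imp_continuous_on, rule ballI)
  fix x assume "x \<in> X"
  then obtain S L where S: "open S" "x \<in> S" "L-lipschitz_on S f" using assms lipschitz_nearE by metis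
  then show "isCont f x"
    using lipschitz_on_continuous_on[OF S(3)] by (simp add: continuous_on_eq_continuous_at)
qed

text \<open>Away from the origin \<open>sgn x - sgn z\<close> splits into the change of the vector at fixed length and the
change of the length, each of norm at most \<open>norm (x - z) / norm x\<close>.\<close>

lemma lipschitz_near_sgn:
  fixes w :: "'a::real_normed_vector"
  assumes "w \<noteq> 0"
  shows "lipschitz_near w sgn"
proof -
  have "(4 / norm w)-lipschitz_on (ball w (norm w / 2)) sgn"
  proof (rule lipschitz_onI)
    fix x z assume "x \<in> ball w (norm w / 2)" "z \<in> ball w (norm w / 2)"
    then have x: "norm w / 2 \<le> norm x" and z: "norm w / 2 \<le> norm z"
      using norm_triangle_ineq2[of w x] norm_triangle_ineq2[of w z] by (auto simp: dist_norm)
    have "0 < norm w" using assms by simp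
    then have pos: "0 < norm w" "0 < norm x" "0 < norm z" using x z by linarith+
    have "(n - m) / m * inverse n = inverse m - inverse n" if "0 < m" "0 < n" for m n :: real
      using that by (simp add: field_simps)
    from this[OF pos(2,3)] have "((norm z - norm x) / norm x) *\<^sub>R sgn z = (inverse (norm x) - inverse (norm z)) *\<^sub>R z"
      by (simp add: sgn_div_norm)
    then have "sgn x - sgn z = (x - z) /\<^sub>R norm x + ((norm z - norm x) / norm x) *\<^sub>R sgn z"
      by (simp add: sgn_div_norm scaleR_diff_left scaleR_diff_right)
    then have "norm (sgn x - sgn z) \<le> norm ((x - z) /\<^sub>R norm x) + norm (((norm z - norm x) / norm x) *\<^sub>R sgn z)"
      by (metis norm_triangle_ineq)
    also have "\<dots> = (norm (x - z) + \<bar>norm z - norm x\<bar>) / norm x"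
      using pos by (simp add: norm_sgn add_divide_distrib divide_inverse abs_mult distrib_left mult.commute)
    also have "\<dots> \<le> (norm (x - z) + norm (x - z)) / (norm w / 2)"
      using pos x norm_triangle_ineq3[of z x] by (intro frac_le) (auto simp: norm_minus_commute)
    also have "\<dots> = 4 / norm w * norm (x - z)" using pos by (simp add: field_simps)
    finally show "dist (sgn x) (sgn z) \<le> 4 / norm w * dist x z" by (simp add: dist_norm)
  qed simp
  then show ?thesis by (rule lipschitz_nearI[rotated 2]) (use assms in auto)
qed

section \<open>Matrix inversion\<close>

lemma bounded_bilinear_matrix_matrix_mult:
  "bounded_bilinear ((**) :: real^'n^'m \<Rightarrow> real^'p^'n \<Rightarrow> real^'p^'m)"
  unfolding bilinear_conv_bounded_bilinear[symmetric] bilinear_def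
  by (auto intro!: linearI simp: matrix_matrix_mult_def vec_eq_iff sum.distrib sum_distrib_left algebra_simps)

lemma bounded_bilinear_matrix_vector_mult:
  "bounded_bilinear ((*v) :: real^'n^'m \<Rightarrow> real^'n \<Rightarrow> real^'m)"
  unfolding bilinear_conv_bounded_bilinear[symmetric] bilinear_def
  by (auto intro!: linearI simp: matrix_vector_mult_def vec_eq_iff sum.distrib sum_distrib_left algebra_simps)

lemma matrix_inv_inverse:
  fixes A :: "'a::semiring_1^'n^'m"
  assumes "invertible A"
  shows "A ** matrix_inv A = mat 1" "matrix_inv A ** A = mat 1"
  using someI_ex[OF assms[unfolded invertible_def]] by (auto simp: matrix_inv_def)

text \<open>With \<open>A'\<close> the inverse of \<open>A\<close>, every \<open>B\<close> near \<open>A\<close> makes \<open>A' (A - B)\<close> small. If \<open>B x = 0\<close> then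
\<open>x = A' (A - B) x\<close>, so \<open>x = 0\<close>; and \<open>B' = A' + A' (A - B) B'\<close> bounds the inverse \<open>B'\<close> of \<open>B\<close>.
The Lipschitz estimate is then read off from \<open>B' - C' = B' (C - B) C'\<close>.\<close>

lemma lipschitz_near_matrix_inv:
  fixes A :: "real^'n^'n"
  assumes A: "invertible A"
  shows "lipschitz_near A matrix_inv"
proof -
  interpret m: bounded_bilinear "(**) :: real^'n^'n \<Rightarrow> real^'n^'n \<Rightarrow> real^'n^'n"
    by (rule bounded_bilinear_matrix_matrix_mult)
  interpret v: bounded_bilinear "(*v) :: real^'n^'n \<Rightarrow> real^'n \<Rightarrow> real^'n"
    by (rule bounded_bilinear_matrix_vector_mult)
  obtain K1 where K1: "0 < K1" "\<And>a b. norm ((a :: real^'n^'n) ** (b :: real^'n^'n)) \<le> norm a * norm b * K1"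
    using m.pos_bounded by blast
  obtain K2 where K2: "0 < K2" "\<And>a b. norm ((a :: real^'n^'n) *v b) \<le> norm a * norm b * K2"
    using v.pos_bounded by blast
  define A' where "A' = matrix_inv A"
  have A': "A' ** A = mat 1" using matrix_inv_inverse(2)[OF A] by (simp add: A'_def)
  \<comment> \<open>The norm of a matrix is here its norm as a vector of entries, which is submultiplicative only up to
    the constants \<open>K1\<close> and \<open>K2\<close>; the radius \<open>e\<close> absorbs them. The summand \<open>1\<close> keeps \<open>a\<close> positive.\<close>
  define a where "a = norm A' + 1"
  have a: "0 < a" "norm A' \<le> a" by (auto simp: a_def add_nonneg_pos)
  define e where "e = min (1 / (2 * (a * K1 * K1))) (1 / (2 * (a * K1 * K2)))"
  have e: "0 < e" using a K1 K2 by (auto simp: e_def)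
  have small: "norm (A' ** (A - B)) * K1 \<le> 1 / 2" "norm (A' ** (A - B)) * K2 \<le> 1 / 2"
    if "B \<in> ball A e" for B
  proof -
    have "norm (A' ** (A - B)) \<le> norm A' * norm (A - B) * K1" by (rule K1)
    also have "\<dots> \<le> a * e * K1" using that a K1 by (intro mult_right_mono mult_mono) (auto simp: dist_norm)
    finally have le: "norm (A' ** (A - B)) \<le> a * e * K1" .
    have *: "e \<le> 1 / (2 * (a * K1 * K1))" "e \<le> 1 / (2 * (a * K1 * K2))" by (auto simp: e_def)
    have "a * e * K1 * K1 \<le> 1 / 2" "a * e * K1 * K2 \<le> 1 / 2"
      using * a K1 K2 by (simp_all add: field_simps)
    then show "norm (A' ** (A - B)) * K1 \<le> 1 / 2" "norm (A' ** (A - B)) * K2 \<le> 1 / 2"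
      using mult_right_mono[OF le, of K1] mult_right_mono[OF le, of K2] K1 K2 by linarith+
  qed
  have inv: "invertible B" if B: "B \<in> ball A e" for B
  proof -
    have "x = 0" if "B *v x = 0" for x
    proof -
      have "A' *v (A *v x) = x" by (simp add: matrix_vector_mul_assoc A')
      then have "x = (A' ** (A - B)) *v x"
        using that by (simp add: matrix_vector_mult_diff_rdistrib flip: matrix_vector_mul_assoc)
      then have "norm x \<le> norm (A' ** (A - B)) * norm x * K2" using K2(2) by metis
      also have "\<dots> = (norm (A' ** (A - B)) * K2) * norm x" by simp
      also have "\<dots> \<le> 1 / 2 * norm x" by (intro mult_right_mono small B) auto
      finally show "x = 0" by simp
    qed
    then show ?thesis unfolding invertible_left_inverse matrix_left_invertible_ker by blast
  qed
  have bound: "norm (matrix_inv B) \<le> 2 * a" if B: "B \<in> ball A e" for B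
  proof -
    let ?B' = "matrix_inv B"
    have "A' ** (A ** ?B') = ?B'" by (simp add: matrix_mul_assoc A')
    moreover have "A' ** (B ** ?B') = A'" using matrix_inv_inverse(1)[OF inv[OF B]] by simp
    ultimately have "?B' = A' + (A' ** (A - B)) ** ?B'"
      by (simp add: m.diff_left m.diff_right flip: matrix_mul_assoc)
    then have "norm ?B' \<le> norm A' + norm ((A' ** (A - B)) ** ?B')" by (metis norm_triangle_ineq)
    also have "\<dots> \<le> norm A' + norm (A' ** (A - B)) * norm ?B' * K1" by (intro add_left_mono K1)
    also have "\<dots> = norm A' + (norm (A' ** (A - B)) * K1) * norm ?B'" by simp
    also have "\<dots> \<le> a + 1 / 2 * norm ?B'" by (intro add_mono mult_right_mono small B a) auto
    finally show ?thesis by simp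
  qed
  have "(2 * a * (2 * a) * K1 * K1)-lipschitz_on (ball A e) matrix_inv"
  proof (rule lipschitz_onI)
    fix B C assume B: "B \<in> ball A e" and C: "C \<in> ball A e"
    let ?B' = "matrix_inv B" and ?C' = "matrix_inv C"
    have "?B' ** (C ** ?C') = ?B'" "?B' ** (B ** ?C') = ?C'"
      using matrix_inv_inverse[OF inv[OF B]] matrix_inv_inverse[OF inv[OF C]]
      by (simp_all add: matrix_mul_assoc[of ?B' B])
    then have "?B' - ?C' = ?B' ** ((C - B) ** ?C')" by (simp add: m.diff_left m.diff_right)
    then have "norm (?B' - ?C') \<le> norm ?B' * norm ((C - B) ** ?C') * K1" using K1(2) by metis
    also have "\<dots> \<le> norm ?B' * (norm (C - B) * norm ?C' * K1) * K1"
      using K1 by (intro mult_right_mono mult_left_mono) auto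
    also have "\<dots> \<le> (2 * a) * (norm (C - B) * (2 * a) * K1) * K1"
      using K1(1) a(1) bound[OF B] bound[OF C] by (intro mult_mono) auto
    finally show "dist ?B' ?C' \<le> 2 * a * (2 * a) * K1 * K1 * dist B C"
      by (simp add: dist_norm norm_minus_commute algebra_simps)
  qed (use a K1 in auto)
  then show ?thesis by (rule lipschitz_nearI[rotated 2]) (use e in auto)
qed

text \<open>The forcing term \<open>g\<close> depends on time alone and is locally bounded, so it only enlarges the Lipschitz
constant of \<open>M\<close> by a factor that is uniform over nearby times.\<close>

lemma local_lipschitz_matrix_forcing:
  fixes M :: "'a::metric_space \<Rightarrow> real^'n^'m" and g :: "real \<Rightarrow> real^'n"
  assumes M: "\<And>x. x \<in> X \<Longrightarrow> lipschitz_near x M" and g: "continuous_on J g"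
  shows "local_lipschitz J X (\<lambda>t x. M x *v g t)"
proof (rule local_lipschitzI)
  interpret v: bounded_bilinear "(*v) :: real^'n^'m \<Rightarrow> real^'n \<Rightarrow> real^'m"
    by (rule bounded_bilinear_matrix_vector_mult)
  obtain K where K: "0 \<le> K" "\<And>(a :: real^'n^'m) b. norm (a *v b) \<le> norm a * norm b * K"
    using v.nonneg_bounded by blast
  fix t x assume t: "t \<in> J" and x: "x \<in> X"
  obtain e L where e: "0 < e" "L-lipschitz_on (ball x e) M"
    using M[OF x] unfolding lipschitz_near_def by blast
  have L: "0 \<le> L" by (rule lipschitz_on_nonneg[OF e(2)])
  obtain d where d: "0 < d" "\<And>s. s \<in> J \<Longrightarrow> dist s t < d \<Longrightarrow> dist (g s) (g t) < 1"
    using g[unfolded continuous_on_iff] t zero_less_one by blast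
  define B where "B = norm (g t) + 1"
  have g_le: "norm (g s) \<le> B" if "s \<in> J" "dist s t < d" for s
    using d(2)[OF that] norm_triangle_ineq2[of "g s" "g t"] by (simp add: B_def dist_norm)
  have B: "0 \<le> B" by (simp add: B_def)
  define u where "u = min e d / 2"
  have u: "0 < u" "u < e" "u < d" using e d by (auto simp: u_def)
  show "\<exists>u>0. \<exists>L. \<forall>s\<in>cball t u \<inter> J. L-lipschitz_on (cball x u \<inter> X) (\<lambda>x. M x *v g s)"
  proof (intro exI conjI ballI)
    show "0 < u" by (rule u(1))
    fix s assume s: "s \<in> cball t u \<inter> J"
    show "(L * B * K)-lipschitz_on (cball x u \<inter> X) (\<lambda>x. M x *v g s)"
    proof (rule lipschitz_onI)
      fix y z assume yz: "y \<in> cball x u \<inter> X" "z \<in> cball x u \<inter> X"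
      have "norm ((M y - M z) *v g s) \<le> norm (M y - M z) * norm (g s) * K" by (rule K)
      also have "\<dots> \<le> (L * dist y z) * B * K"
        using yz s u L K(1) B lipschitz_onD[OF e(2), of y z] g_le[of s]
        by (intro mult_right_mono mult_mono) (auto simp: dist_norm norm_minus_commute)
      finally show "dist (M y *v g s) (M z *v g s) \<le> L * B * K * dist y z"
        by (simp add: dist_norm v.diff_left algebra_simps)
    qed (use L B K in auto)
  qed
qed

section \<open>Functions with continuous partial derivatives\<close>

text \<open>\<open>C1_on\<close> speaks of partial derivatives only. Their continuity upgrades them to a Frechet derivative,
which gives access to derivatives in arbitrary directions.\<close>

lemma C1_on_has_derivative:
  fixes f :: "real \<times> real \<Rightarrow> 'a::real_normed_vector"
  assumes "open U" "C1_on U f" "p \<in> U"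
  shows "(f has_derivative (\<lambda>h. fst h *\<^sub>R partial_u f p + snd h *\<^sub>R partial_v f p)) (at p)"
proof -
  obtain x y where p: "p = (x, y)" by (cases p)
  obtain X Y where XY: "open X" "open Y" "x \<in> X" "y \<in> Y" "X \<times> Y \<subseteq> U"
    using assms(1,3) p open_prod_elim[of U p] by (metis mem_Sigma_iff)
  obtain e where e: "0 < e" "ball y e \<subseteq> Y" using XY openE by blast
  let ?Y = "ball y e"
  have sub: "X \<times> ?Y \<subseteq> U" using XY e by auto
  have "((\<lambda>(x, y). f (x, y)) has_derivative
      (\<lambda>(tx, ty). tx *\<^sub>R partial_u f (x, y) + blinfun_scaleR_left (partial_v f (x, y)) ty))
      (at (x, y) within X \<times> ?Y)"
  proof (rule has_derivative_partialsI[where f = "\<lambda>x y. f (x, y)"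
        and fy = "\<lambda>x y. blinfun_scaleR_left (partial_v f (x, y))"
        and fx = "\<lambda>tx. tx *\<^sub>R partial_u f (x, y)"])
    have "(\<lambda>s. f (s, y)) differentiable (at x)" using assms p by (auto simp: C1_on_def)
    then show "((\<lambda>x. f (x, y)) has_derivative (\<lambda>tx. tx *\<^sub>R partial_u f (x, y))) (at x within X)"
      unfolding partial_u_def vector_derivative_works has_vector_derivative_def
      by (auto intro: has_derivative_at_withinI)
    fix x' y' assume "x' \<in> X" "y' \<in> ?Y"
    then have "(x', y') \<in> U" using sub by auto
    then have "(\<lambda>s. f (x', s)) differentiable (at y')" using assms by (auto simp: C1_on_def)
    then show "((\<lambda>y. f (x', y)) has_derivative blinfun_scaleR_left (partial_v f (x', y'))) (at y' within ?Y)"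
      unfolding partial_v_def vector_derivative_works has_vector_derivative_def
      by (auto intro: has_derivative_at_withinI)
  next
    have "continuous_on (X \<times> ?Y) (\<lambda>p. blinfun_scaleR_left (partial_v f p))"
      using assms(2) sub
      by (intro bounded_linear.continuous_on[OF bounded_linear_blinfun_scaleR_left])
         (auto simp: C1_on_def intro: continuous_on_subset)
    then show "continuous (at (x, y) within X \<times> ?Y) (\<lambda>(x, y). blinfun_scaleR_left (partial_v f (x, y)))"
      using XY e by (auto simp: continuous_on_eq_continuous_within case_prod_unfold)
  qed (use e in auto)
  moreover have "at (x, y) within X \<times> ?Y = at (x, y)"
    using XY e by (intro at_within_open) (auto intro: open_Times)
  ultimately show ?thesis by (simp add: p case_prod_unfold)
qed

text \<open>On a compact ball both partial derivatives are bounded, and hence so is the operator norm of the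
Frechet derivative.\<close>

lemma C1_on_lipschitz_near:
  fixes f :: "real \<times> real \<Rightarrow> 'a::real_normed_vector"
  assumes "open U" "C1_on U f" "p \<in> U"
  shows "lipschitz_near p f"
proof -
  obtain e where e: "0 < e" "cball p e \<subseteq> U" using assms open_contains_cball by blast
  have "bounded (partial_u f ` cball p e)" "bounded (partial_v f ` cball p e)"
    using assms(2) e by (auto simp: C1_on_def intro!: compact_imp_bounded compact_continuous_image
        intro: continuous_on_subset)
  then obtain A B where A: "0 < A" "\<And>q. q \<in> cball p e \<Longrightarrow> norm (partial_u f q) \<le> A"
    and B: "0 < B" "\<And>q. q \<in> cball p e \<Longrightarrow> norm (partial_v f q) \<le> B"
    unfolding bounded_pos by (metis imageI)
  have "(A + B)-lipschitz_on (ball p e) f"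
  proof (rule bounded_derivative_imp_lipschitz)
    fix q assume q: "q \<in> ball p e"
    then have "q \<in> U" using e by auto
    then show "(f has_derivative (\<lambda>h. fst h *\<^sub>R partial_u f q + snd h *\<^sub>R partial_v f q)) (at q within ball p e)"
      using C1_on_has_derivative[OF assms(1,2)] has_derivative_at_withinI by blast
    show "onorm (\<lambda>h. fst h *\<^sub>R partial_u f q + snd h *\<^sub>R partial_v f q) \<le> A + B"
    proof (rule onorm_le)
      fix h :: "real \<times> real"
      have "norm (fst h *\<^sub>R partial_u f q + snd h *\<^sub>R partial_v f q)
          \<le> norm (fst h) * norm (partial_u f q) + norm (snd h) * norm (partial_v f q)"
        by (metis norm_scaleR norm_triangle_ineq real_norm_def)
      also have "\<dots> \<le> norm h * A + norm h * B"
        using A B q norm_fst_le[of "fst h" "snd h"] norm_snd_le[of "snd h" "fst h"]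
          by (intro add_mono mult_mono) auto
      finally show "norm (fst h *\<^sub>R partial_u f q + snd h *\<^sub>R partial_v f q) \<le> (A + B) * norm h"
        by (simp add: algebra_simps)
    qed
  qed (use A B in auto)
  then show ?thesis by (rule lipschitz_nearI[rotated 2]) (use e in auto)
qed

lemma partial_eq_has_derivative:
  assumes "(f has_derivative D) (at p)"
  shows "partial_u f p = D (1, 0)" "partial_v f p = D (0, 1)"
proof -
  interpret D: bounded_linear D by (rule has_derivative_bounded_linear[OF assms])
  have eq: "(\<lambda>h. h *\<^sub>R D (1, 0)) = (\<lambda>h. D (h, 0))" "(\<lambda>h. h *\<^sub>R D (0, 1)) = (\<lambda>h. D (0, h))"
    by (simp_all add: fun_eq_iff flip: D.scaleR)
  have "((\<lambda>s. f (s, snd p)) has_vector_derivative D (1, 0)) (at (fst p))"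
    unfolding has_vector_derivative_def eq
    by (rule has_derivative_compose[where g = f and g' = D and f = "\<lambda>s. (s, snd p)"])
       (auto intro!: derivative_eq_intros assms)
  then show "partial_u f p = D (1, 0)" unfolding partial_u_def by (rule vector_derivative_at)
  have "((\<lambda>s. f (fst p, s)) has_vector_derivative D (0, 1)) (at (snd p))"
    unfolding has_vector_derivative_def eq
    by (rule has_derivative_compose[where g = f and g' = D and f = "\<lambda>s. (fst p, s)"])
       (auto intro!: derivative_eq_intros assms)
  then show "partial_v f p = D (0, 1)" unfolding partial_v_def by (rule vector_derivative_at)
qed

lemma has_derivative_partials:
  assumes "f differentiable (at p)"
  shows "(f has_derivative (\<lambda>h. fst h *\<^sub>R partial_u f p + snd h *\<^sub>R partial_v f p)) (at p)"
proof -
  obtain D where D: "(f has_derivative D) (at p)" using assms by (auto simp: differentiable_def)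
  interpret D: bounded_linear D by (rule has_derivative_bounded_linear[OF D])
  have "fst h *\<^sub>R D (1, 0) + snd h *\<^sub>R D (0, 1) = D h" for h
    by (simp flip: D.scaleR D.add)
  with D show ?thesis by (simp add: partial_eq_has_derivative[OF D])
qed

section \<open>Linear algebra of the cross product\<close>

lemma cross3_combination_zero:
  fixes a b :: "real^3"
  assumes "cross3 a b \<noteq> 0" and eq: "\<alpha> *\<^sub>R a + \<beta> *\<^sub>R b = 0"
  shows "\<alpha> = 0 \<and> \<beta> = 0"
proof -
  have "cross3 (\<alpha> *\<^sub>R a + \<beta> *\<^sub>R b) b = \<alpha> *\<^sub>R cross3 a b" "cross3 a (\<alpha> *\<^sub>R a + \<beta> *\<^sub>R b) = \<beta> *\<^sub>R cross3 a b"
    by (simp_all add: cross_add_left cross_add_right cross_mult_left cross_mult_right)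
  then have "\<alpha> *\<^sub>R cross3 a b = 0" "\<beta> *\<^sub>R cross3 a b = 0"
    unfolding eq cross_zero_left cross_zero_right by metis+
  then show ?thesis using assms(1) by simp
qed

text \<open>Expanding \<open>N \<times> (w \<times> N)\<close> for \<open>N = a \<times> b\<close> in two ways by Lagrange's formula gives \<open>(N \<bullet> N) w\<close>, as \<open>w\<close> is orthogonal
to \<open>N\<close>, and an explicit combination of \<open>a\<close> and \<open>b\<close>.\<close>

lemma orthogonal_cross3_combination:
  fixes a b w :: "real^3"
  assumes N: "cross3 a b \<noteq> 0" and orth: "w \<bullet> cross3 a b = 0"
  obtains \<alpha> \<beta> where "w = \<alpha> *\<^sub>R a + \<beta> *\<^sub>R b"
proof -
  define N where "N = cross3 a b"
  have "N \<bullet> w = 0" using orth by (simp add: N_def inner_commute)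
  then have "(N \<bullet> N) *\<^sub>R w = cross3 N (cross3 w N)" by (simp add: Lagrange)
  also have "cross3 w N = (w \<bullet> b) *\<^sub>R a - (w \<bullet> a) *\<^sub>R b"
    by (simp add: N_def Lagrange)
  also have "cross3 N \<dots> = (w \<bullet> b) *\<^sub>R cross3 N a - (w \<bullet> a) *\<^sub>R cross3 N b"
    by (simp add: Cross3.right_diff_distrib cross_mult_right)
  also have "cross3 N a = (a \<bullet> a) *\<^sub>R b - (a \<bullet> b) *\<^sub>R a"
    using cross_skew[of N a] by (simp add: N_def Lagrange)
  also have "cross3 N b = (a \<bullet> b) *\<^sub>R b - (b \<bullet> b) *\<^sub>R a"
    using cross_skew[of N b] by (simp add: N_def Lagrange inner_commute)
  finally have eq: "(N \<bullet> N) *\<^sub>R w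
      = ((w \<bullet> a) * (b \<bullet> b) - (w \<bullet> b) * (a \<bullet> b)) *\<^sub>R a + ((w \<bullet> b) * (a \<bullet> a) - (w \<bullet> a) * (a \<bullet> b)) *\<^sub>R b"
    by (simp add: algebra_simps)
  have "N \<bullet> N \<noteq> 0" using N by (simp add: N_def)
  then have "w = inverse (N \<bullet> N) *\<^sub>R ((N \<bullet> N) *\<^sub>R w)" by simp
  then show ?thesis using that unfolding eq scaleR_add_right scaleR_scaleR by blast
qed

text \<open>By Lagrange's formula, \<open>w \<times> (a \<times> b) = 0\<close>, that is, \<open>w\<close> is parallel to \<open>a \<times> b\<close>; projecting onto the unit vector
finds the factor.\<close>

lemma orthogonal_to_both_parallel_cross3:
  fixes a b w :: "real^3"
  assumes N: "cross3 a b \<noteq> 0" and "w \<bullet> a = 0" "w \<bullet> b = 0"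
  shows "w = (w \<bullet> sgn (cross3 a b)) *\<^sub>R sgn (cross3 a b)"
proof -
  let ?n = "sgn (cross3 a b)"
  have "cross3 w ?n = 0" using assms by (simp add: sgn_div_norm cross_mult_right Lagrange)
  then have "cross3 ?n (cross3 w ?n) = 0" by simp
  moreover have "?n \<bullet> ?n = 1" using N by (simp add: norm_sgn flip: power2_norm_eq_inner)
  ultimately show ?thesis by (simp add: Lagrange inner_commute)
qed

section \<open>The unit normal and the Weingarten matrix\<close>

lemma unit_normal_eq_sgn: "unit_normal \<sigma> p = sgn (cross3 (partial_u \<sigma> p) (partial_v \<sigma> p))"
  by (simp add: unit_normal_def sgn_div_norm)

lemma regular_on_cross3_nonzero:
  assumes "regular_on U \<sigma>" "p \<in> U"
  shows "cross3 (partial_u \<sigma> p) (partial_v \<sigma> p) \<noteq> 0"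
proof
  let ?a = "partial_u \<sigma> p" and ?b = "partial_v \<sigma> p"
  have ab: "?b \<noteq> ?a" "independent {?b, ?a}" using assms by (auto simp: regular_on_def insert_commute)
  assume "cross3 ?a ?b = 0"
  then have "?a = 0 \<or> ?b = 0 \<or> (\<exists>c. ?b = c *\<^sub>R ?a)" by (simp add: cross_eq_0 collinear_lemma)
  moreover have "?a \<noteq> 0" "?b \<noteq> 0" using ab(2) dependent_zero[of "{?b, ?a}"] by auto
  moreover have "?b \<notin> span {?a}" using ab independent_insert[of ?b "{?a}"] by simp
  ultimately show False by (auto simp: span_singleton)
qed

lemma unit_normal_differentiable:
  assumes "open U" "C2_on U \<sigma>" "regular_on U \<sigma>" "p \<in> U"
  shows "unit_normal \<sigma> differentiable (at p)"
proof -
  have d: "partial_u \<sigma> differentiable (at p)" "partial_v \<sigma> differentiable (at p)"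
    using C1_on_has_derivative[OF assms(1) _ assms(4)] assms(2)
    unfolding C2_on_def differentiable_def by blast+
  have "bounded_bilinear cross3" using bilinear_cross by (simp add: bilinear_conv_bounded_bilinear)
  from bounded_bilinear.FDERIV[OF this] d
  have N: "(\<lambda>q. cross3 (partial_u \<sigma> q) (partial_v \<sigma> q)) differentiable (at p)" (is "?N differentiable _")
    unfolding differentiable_def by blast
  have N0: "?N p \<noteq> 0" using regular_on_cross3_nonzero assms by blast
  then have "(\<lambda>q. norm (?N q)) differentiable (at p)"
    using differentiable_chain_at[OF N differentiable_norm_at] by (simp add: o_def)
  then have "(\<lambda>q. inverse (norm (?N q))) differentiable (at p)"
    using N0 by (intro differentiable_inverse) auto
  then show ?thesis
    unfolding unit_normal_def[abs_def] by (intro differentiable_scaleR N)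
qed

text \<open>The function \<open>n \<bullet> n\<close> is constant, so its derivative \<open>2 (Dn h \<bullet> n)\<close> vanishes.\<close>

lemma unit_normal_orthogonal_derivative:
  assumes "open U" "C2_on U \<sigma>" "regular_on U \<sigma>" "p \<in> U"
    and D: "(unit_normal \<sigma> has_derivative D) (at p)"
  shows "D h \<bullet> unit_normal \<sigma> p = 0"
proof -
  have one: "unit_normal \<sigma> q \<bullet> unit_normal \<sigma> q = 1" if "q \<in> U" for q
    using regular_on_cross3_nonzero[OF assms(3) that]
    by (simp add: unit_normal_eq_sgn norm_sgn flip: power2_norm_eq_inner)
  have "((\<lambda>q. unit_normal \<sigma> q \<bullet> unit_normal \<sigma> q) has_derivative
      (\<lambda>h. unit_normal \<sigma> p \<bullet> D h + D h \<bullet> unit_normal \<sigma> p)) (at p)"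
    by (rule has_derivative_inner[OF D D])
  then have "(\<lambda>h. unit_normal \<sigma> p \<bullet> D h + D h \<bullet> unit_normal \<sigma> p) = (\<lambda>h. 0)"
    by (rule differential_zero_maxmin[OF assms(4,1)]) (simp add: one assms(4))
  from fun_cong[OF this, of h] show ?thesis by (simp add: inner_commute)
qed

text \<open>The definite description defining \<open>weingarten\<close> denotes: the derivatives of \<open>n\<close> are orthogonal
to \<open>n\<close>, hence tangent to the surface, and the coefficients with respect to the basis \<open>\<sigma>\<^sub>u\<close>, \<open>\<sigma>\<^sub>v\<close> of the
tangent plane are unique.\<close>

lemma weingarten_equations:
  assumes "open U" "C2_on U \<sigma>" "regular_on U \<sigma>" "p \<in> U"
  defines "W \<equiv> weingarten \<sigma> p"
  shows "partial_u (unit_normal \<sigma>) p = (W $ 1 $ 1) *\<^sub>R partial_u \<sigma> p + (W $ 2 $ 1) *\<^sub>R partial_v \<sigma> p"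
    and "partial_v (unit_normal \<sigma>) p = (W $ 1 $ 2) *\<^sub>R partial_u \<sigma> p + (W $ 2 $ 2) *\<^sub>R partial_v \<sigma> p"
proof -
  let ?a = "partial_u \<sigma> p" and ?b = "partial_v \<sigma> p" and ?n = "unit_normal \<sigma>"
  have N: "cross3 ?a ?b \<noteq> 0" by (rule regular_on_cross3_nonzero[OF assms(3,4)])
  obtain D where D: "(?n has_derivative D) (at p)"
    using unit_normal_differentiable[OF assms(1-4)] by (auto simp: differentiable_def)
  have "D h \<bullet> cross3 ?a ?b = 0" for h
    using unit_normal_orthogonal_derivative[OF assms(1-4) D, of h] N by (simp add: unit_normal_def)
  then have comb: "\<exists>\<alpha> \<beta>. D h = \<alpha> *\<^sub>R ?a + \<beta> *\<^sub>R ?b" for h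
    using orthogonal_cross3_combination[OF N] by metis
  obtain \<alpha> \<beta> where u: "partial_u ?n p = \<alpha> *\<^sub>R ?a + \<beta> *\<^sub>R ?b"
    using comb partial_eq_has_derivative(1)[OF D] by metis
  obtain \<gamma> \<delta> where v: "partial_v ?n p = \<gamma> *\<^sub>R ?a + \<delta> *\<^sub>R ?b"
    using comb partial_eq_has_derivative(2)[OF D] by metis
  have unique: "\<alpha> = \<alpha>' \<and> \<beta> = \<beta>'" if "\<alpha> *\<^sub>R ?a + \<beta> *\<^sub>R ?b = \<alpha>' *\<^sub>R ?a + \<beta>' *\<^sub>R ?b" for \<alpha> \<beta> \<alpha>' \<beta>'
    using cross3_combination_zero[OF N, of "\<alpha> - \<alpha>'" "\<beta> - \<beta>'"] that by (simp add: algebra_simps)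
  have "\<exists>!W :: real^2^2. partial_u ?n p = (W $ 1 $ 1) *\<^sub>R ?a + (W $ 2 $ 1) *\<^sub>R ?b \<and>
      partial_v ?n p = (W $ 1 $ 2) *\<^sub>R ?a + (W $ 2 $ 2) *\<^sub>R ?b" (is "\<exists>!W. ?Q W")
  proof (rule ex1I)
    show "?Q (vector [vector [\<alpha>, \<gamma>], vector [\<beta>, \<delta>]])" by (simp add: u v)
    fix W :: "real^2^2" assume "?Q W"
    then show "W = vector [vector [\<alpha>, \<gamma>], vector [\<beta>, \<delta>]]"
      using unique[of \<alpha> \<beta> "W $ 1 $ 1" "W $ 2 $ 1"] unique[of \<gamma> \<delta> "W $ 1 $ 2" "W $ 2 $ 2"]
      by (simp add: u v vec_eq_iff forall_2)
  qed
  from theI'[OF this] show "partial_u ?n p = (W $ 1 $ 1) *\<^sub>R ?a + (W $ 2 $ 1) *\<^sub>R ?b"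
      "partial_v ?n p = (W $ 1 $ 2) *\<^sub>R ?a + (W $ 2 $ 2) *\<^sub>R ?b"
    unfolding W_def weingarten_def by auto
qed

section \<open>Convexity\<close>

text \<open>Some nonzero \<open>a\<close> supports \<open>K\<close> at the boundary point \<open>\<sigma> p\<close>. Since \<open>\<sigma>\<close> takes values in \<open>K\<close>, the function \<open>a \<bullet> \<sigma>\<close> is
minimal at \<open>p\<close>, so \<open>a\<close> is orthogonal to both tangent vectors and is a multiple of \<open>n\<close>. The factor is
positive because \<open>n\<close> points into \<open>K\<close>.\<close>

lemma inward_normal_supports:
  assumes K: "closed K" "convex K" "interior K \<noteq> {}"
    and U: "open U" "\<sigma> ` U \<subseteq> frontier K" "C1_on U \<sigma>" "regular_on U \<sigma>" "p \<in> U"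
    and inward: "points_into K (\<sigma> p) (unit_normal \<sigma> p)" and "x \<in> K"
  shows "0 \<le> unit_normal \<sigma> p \<bullet> (x - \<sigma> p)"
proof -
  have bd: "\<sigma> q \<in> K" "\<sigma> q \<notin> interior K" if "q \<in> U" for q
    using U(2) K(1) that by (auto simp: frontier_def)
  have "\<sigma> p \<notin> rel_interior K" using bd K(3) U(5) by (simp add: rel_interior_nonempty_interior)
  then obtain a where a: "a \<noteq> 0" "\<And>y. y \<in> K \<Longrightarrow> a \<bullet> \<sigma> p \<le> a \<bullet> y"
    using supporting_hyperplane_rel_boundary[OF K(2) bd(1)[OF U(5)]] by metis
  have "((\<lambda>q. a \<bullet> \<sigma> q) has_derivative
      (\<lambda>h. a \<bullet> (fst h *\<^sub>R partial_u \<sigma> p + snd h *\<^sub>R partial_v \<sigma> p))) (at p)"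
    by (intro has_derivative_inner_right C1_on_has_derivative[OF U(1,3,5)])
  then have zero: "(\<lambda>h. a \<bullet> (fst h *\<^sub>R partial_u \<sigma> p + snd h *\<^sub>R partial_v \<sigma> p)) = (\<lambda>h. 0)"
    by (rule differential_zero_maxmin[OF U(5,1)]) (use a(2) bd in auto)
  have "a \<bullet> partial_u \<sigma> p = 0" "a \<bullet> partial_v \<sigma> p = 0"
    using fun_cong[OF zero, of "(1, 0)"] fun_cong[OF zero, of "(0, 1)"] by auto
  then have an: "a = (a \<bullet> unit_normal \<sigma> p) *\<^sub>R unit_normal \<sigma> p"
    using orthogonal_to_both_parallel_cross3[OF regular_on_cross3_nonzero[OF U(4,5)]]
    by (simp add: unit_normal_eq_sgn)
  obtain \<epsilon> where "0 < \<epsilon>" "\<And>s. 0 < s \<Longrightarrow> s < \<epsilon> \<Longrightarrow> \<sigma> p + s *\<^sub>R unit_normal \<sigma> p \<in> interior K"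
    using inward by (auto simp: points_into_def)
  then have "\<sigma> p + (\<epsilon> / 2) *\<^sub>R unit_normal \<sigma> p \<in> K"
    using interior_subset[of K] by force
  from a(2)[OF this] have "0 \<le> a \<bullet> unit_normal \<sigma> p" using \<open>0 < \<epsilon>\<close>
    by (simp add: inner_add_right zero_le_mult_iff)
  moreover have "a \<bullet> unit_normal \<sigma> p \<noteq> 0" using an a(1) by auto
  ultimately have pos: "0 < a \<bullet> unit_normal \<sigma> p" by simp
  have "0 \<le> a \<bullet> (x - \<sigma> p)" using a(2)[OF \<open>x \<in> K\<close>] by (simp add: inner_diff_right)
  also have "\<dots> = (a \<bullet> unit_normal \<sigma> p) * (unit_normal \<sigma> p \<bullet> (x - \<sigma> p))"
    by (subst an) simp
  finally show ?thesis using pos by (simp add: zero_le_mult_iff)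
qed

text \<open>Along the line through \<open>p\<close> in direction \<open>h\<close>, both difference quotients are divided by the same \<open>t\<close>, so their
inner product is \<open>1 / t\<^sup>2\<close> times a nonpositive number whatever the sign of \<open>t\<close>.\<close>

lemma antimonotone_pair_derivative:
  fixes F G :: "'a::real_normed_vector \<Rightarrow> 'b::real_inner"
  assumes F: "(F has_derivative F') (at p)" and G: "(G has_derivative G') (at p)"
    and "open U" "p \<in> U" and neg: "\<And>q. q \<in> U \<Longrightarrow> (F q - F p) \<bullet> (G q - G p) \<le> 0"
  shows "F' h \<bullet> G' h \<le> 0"
proof -
  have lim: "((\<lambda>t. (H (p + t *\<^sub>R h) - H p) /\<^sub>R t) \<longlongrightarrow> H' h) (at (0::real))"
    if H: "(H has_derivative H') (at p)" for H :: "'a \<Rightarrow> 'b" and H'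
  proof -
    interpret H': bounded_linear H' by (rule has_derivative_bounded_linear[OF H])
    have "((\<lambda>t. H (p + t *\<^sub>R h)) has_derivative (\<lambda>t. H' (t *\<^sub>R h))) (at 0)"
      by (rule has_derivative_compose[where g = H and g' = H' and f = "\<lambda>t. p + t *\<^sub>R h"])
         (auto intro!: derivative_eq_intros H)
    then have "((\<lambda>t. norm (H (p + t *\<^sub>R h) - H p - t *\<^sub>R H' h) / norm t) \<longlongrightarrow> 0) (at (0::real))"
      by (simp add: has_derivative_iff_norm H'.scaleR)
    moreover have "\<forall>\<^sub>F t in at (0::real). norm (H (p + t *\<^sub>R h) - H p - t *\<^sub>R H' h) / norm t
        = norm ((H (p + t *\<^sub>R h) - H p) /\<^sub>R t - H' h)"
      unfolding eventually_at_filter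
    proof (intro always_eventually allI impI)
      fix t :: real assume "t \<noteq> 0"
      then have "(H (p + t *\<^sub>R h) - H p) /\<^sub>R t - H' h = (H (p + t *\<^sub>R h) - H p - t *\<^sub>R H' h) /\<^sub>R t"
        by (simp add: scaleR_diff_right)
      then show "norm (H (p + t *\<^sub>R h) - H p - t *\<^sub>R H' h) / norm t
          = norm ((H (p + t *\<^sub>R h) - H p) /\<^sub>R t - H' h)"
        by (simp add: divide_inverse mult.commute)
    qed
    ultimately have "((\<lambda>t. norm ((H (p + t *\<^sub>R h) - H p) /\<^sub>R t - H' h)) \<longlongrightarrow> 0) (at (0::real))"
      by (rule Lim_transform_eventually)
    then show ?thesis by (rule LIM_zero_cancel[OF tendsto_norm_zero_cancel])
  qed
  have "((\<lambda>t. p + t *\<^sub>R h) \<longlongrightarrow> p) (at (0::real))" by (auto intro!: tendsto_eq_intros)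
  then have "\<forall>\<^sub>F t in at (0::real). p + t *\<^sub>R h \<in> U" using assms(3,4) by (rule topological_tendstoD)
  then have "\<forall>\<^sub>F t in at 0. ((F (p + t *\<^sub>R h) - F p) /\<^sub>R t) \<bullet> ((G (p + t *\<^sub>R h) - G p) /\<^sub>R t) \<le> 0"
  proof (rule eventually_mono)
    fix t :: real assume "p + t *\<^sub>R h \<in> U"
    then have "inverse t * inverse t * ((F (p + t *\<^sub>R h) - F p) \<bullet> (G (p + t *\<^sub>R h) - G p)) \<le> 0"
      by (intro mult_nonneg_nonpos neg) auto
    then show "((F (p + t *\<^sub>R h) - F p) /\<^sub>R t) \<bullet> ((G (p + t *\<^sub>R h) - G p) /\<^sub>R t) \<le> 0"
      by (simp add: mult.assoc)
  qed
  then show ?thesis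
    by (rule tendsto_upperbound[OF tendsto_inner[OF lim[OF F] lim[OF G]]]) simp
qed

text \<open>This is the statement that the second fundamental form of a convex surface has a sign. It follows from
the monotonicity of the normal, obtained by adding the supporting inequalities at \<open>p\<close> and \<open>q\<close>.\<close>

lemma derivative_normal_nonpositive:
  assumes K: "closed K" "convex K" "interior K \<noteq> {}"
    and U: "open U" "\<sigma> ` U \<subseteq> frontier K" "C2_on U \<sigma>" "regular_on U \<sigma>"
    and inward: "\<And>p. p \<in> U \<Longrightarrow> points_into K (\<sigma> p) (unit_normal \<sigma> p)" and p: "p \<in> U"
  shows "(x *\<^sub>R partial_u \<sigma> p + y *\<^sub>R partial_v \<sigma> p) \<bullet>
    (x *\<^sub>R partial_u (unit_normal \<sigma>) p + y *\<^sub>R partial_v (unit_normal \<sigma>) p) \<le> 0"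
proof -
  have C1: "C1_on U \<sigma>" using U(3) by (simp add: C2_on_def)
  have "(\<sigma> q - \<sigma> p) \<bullet> (unit_normal \<sigma> q - unit_normal \<sigma> p) \<le> 0" if q: "q \<in> U" for q
  proof -
    have "\<sigma> p \<in> K" "\<sigma> q \<in> K" using U(2) K(1) p q by (auto simp: frontier_def)
    then have "0 \<le> unit_normal \<sigma> p \<bullet> (\<sigma> q - \<sigma> p)" "0 \<le> unit_normal \<sigma> q \<bullet> (\<sigma> p - \<sigma> q)"
      using inward_normal_supports[OF K U(1,2) C1 U(4)] inward p q by blast+
    then show ?thesis by (simp add: algebra_simps inner_diff_left inner_diff_right inner_commute)
  qed
  from antimonotone_pair_derivative[OF C1_on_has_derivative[OF U(1) C1 p]
      has_derivative_partials[OF unit_normal_differentiable[OF U(1,3,4) p]] U(1) p this, of "(x, y)"]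
  show ?thesis by simp
qed

section \<open>Regularity of the right-hand side\<close>

text \<open>For \<open>x\<close> in the kernel, the vectors \<open>d = D\<sigma> x\<close> and \<open>e = Dn x\<close> satisfy \<open>d = r e\<close>, while convexity gives
\<open>d \<bullet> e \<le> 0\<close>. Both vanish, and \<open>D\<sigma>\<close> is injective.\<close>

lemma invertible_one_minus_weingarten:
  assumes K: "closed K" "convex K" "interior K \<noteq> {}"
    and U: "open U" "\<sigma> ` U \<subseteq> frontier K" "C2_on U \<sigma>" "regular_on U \<sigma>"
    and inward: "\<And>p. p \<in> U \<Longrightarrow> points_into K (\<sigma> p) (unit_normal \<sigma> p)" and p: "p \<in> U" and r: "0 < r"
  shows "invertible (mat 1 - r *\<^sub>R weingarten \<sigma> p)"
proof -
  let ?W = "weingarten \<sigma> p" and ?n = "unit_normal \<sigma>"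
  have "x = 0" if "(mat 1 - r *\<^sub>R ?W) *v x = 0" for x :: "real^2"
  proof -
    have x: "x $ 1 = r * (?W $ 1 $ 1 * x $ 1 + ?W $ 1 $ 2 * x $ 2)"
        "x $ 2 = r * (?W $ 2 $ 1 * x $ 1 + ?W $ 2 $ 2 * x $ 2)"
      using that by (simp_all add: vec_eq_iff forall_2 matrix_vector_mult_def sum_2 mat_def algebra_simps)
    define d where "d = (x $ 1) *\<^sub>R partial_u \<sigma> p + (x $ 2) *\<^sub>R partial_v \<sigma> p"
    define e where "e = (x $ 1) *\<^sub>R partial_u ?n p + (x $ 2) *\<^sub>R partial_v ?n p"
    have "r *\<^sub>R e = (r * (?W $ 1 $ 1 * x $ 1 + ?W $ 1 $ 2 * x $ 2)) *\<^sub>R partial_u \<sigma> p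
        + (r * (?W $ 2 $ 1 * x $ 1 + ?W $ 2 $ 2 * x $ 2)) *\<^sub>R partial_v \<sigma> p"
      unfolding e_def weingarten_equations[OF U(1,3,4) p] by (simp add: algebra_simps)
    then have de: "d = r *\<^sub>R e" using x by (simp add: d_def)
    have "d \<bullet> e \<le> 0" unfolding d_def e_def by (rule derivative_normal_nonpositive[OF K U inward p])
    then have "r * (e \<bullet> e) \<le> 0" by (simp add: de)
    then have "e \<bullet> e \<le> 0" using r by (simp add: mult_le_0_iff)
    then have "e = 0" using inner_ge_zero[of e] by (metis antisym inner_eq_zero_iff)
    then have "d = 0" by (simp add: de)
    then have "x $ 1 = 0 \<and> x $ 2 = 0"
      unfolding d_def by (rule cross3_combination_zero[OF regular_on_cross3_nonzero[OF U(4) p]])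
    then show "x = 0" by (simp add: vec_eq_iff forall_2)
  qed
  then show ?thesis unfolding invertible_left_inverse matrix_left_invertible_ker by blast
qed

lemma invertible_frame_matrix:
  assumes "regular_on U \<sigma>" "p \<in> U"
  shows "invertible (frame_matrix \<sigma> p)"
proof -
  let ?a = "partial_u \<sigma> p" and ?b = "partial_v \<sigma> p" and ?n = "unit_normal \<sigma> p"
  have N: "cross3 ?a ?b \<noteq> 0" by (rule regular_on_cross3_nonzero[OF assms])
  have "y = 0" if "frame_matrix \<sigma> p *v y = 0" for y
  proof -
    have eq: "(y $ 1) *\<^sub>R ?a + (y $ 2) *\<^sub>R ?b + (y $ 3) *\<^sub>R ?n = 0"
      using that by (simp add: frame_matrix_def vec_eq_iff forall_3 matrix_vector_mult_def sum_3 transpose_def mult.commute)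
    have "((y $ 1) *\<^sub>R ?a + (y $ 2) *\<^sub>R ?b + (y $ 3) *\<^sub>R ?n) \<bullet> ?n = y $ 3 * (?n \<bullet> ?n)"
      by (simp add: inner_add_left unit_normal_def dot_cross_self)
    also have "?n \<bullet> ?n = 1" using N by (simp add: unit_normal_eq_sgn norm_sgn flip: power2_norm_eq_inner)
    finally have "y $ 3 = 0" using eq by simp
    then show "y = 0" using cross3_combination_zero[OF N, of "y $ 1" "y $ 2"] eq
      by (simp add: vec_eq_iff forall_3)
  qed
  then show ?thesis unfolding invertible_left_inverse matrix_left_invertible_ker by blast
qed

lemma lipschitz_near_block_diag:
  assumes "lipschitz_near x A"
  shows "lipschitz_near x (\<lambda>z. block_diag (A z) b)"
proof (intro lipschitz_near_vecI)
  have "lipschitz_near x (\<lambda>z. A z $ i $ j)" for i j by (intro lipschitz_near_nth assms)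
  moreover fix i j :: 3
  have "i \<in> {1, 2, 3}" "j \<in> {1, 2, 3}" using exhaust_3 by auto
  ultimately show "lipschitz_near x (\<lambda>z. block_diag (A z) b $ i $ j)"
    by (auto simp: block_diag_def lipschitz_near_const)
qed

lemma lipschitz_near_frame_matrix:
  assumes U: "open U" "C2_on U \<sigma>" "regular_on U \<sigma>" "p \<in> U"
  shows "lipschitz_near p (frame_matrix \<sigma>)"
proof (intro lipschitz_near_vecI)
  have a: "lipschitz_near p (partial_u \<sigma>)" and b: "lipschitz_near p (partial_v \<sigma>)"
    using U(2) by (auto simp: C2_on_def intro: C1_on_lipschitz_near[OF U(1) _ U(4)])
  have "bounded_bilinear cross3" using bilinear_cross by (simp add: bilinear_conv_bounded_bilinear)
  then have "lipschitz_near p (\<lambda>q. cross3 (partial_u \<sigma> q) (partial_v \<sigma> q))"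
    using a b by (rule bounded_bilinear.lipschitz_near)
  then have n: "lipschitz_near p (unit_normal \<sigma>)"
    unfolding unit_normal_eq_sgn[abs_def]
    by (rule lipschitz_near_compose) (rule lipschitz_near_sgn[OF regular_on_cross3_nonzero[OF U(3,4)]])
  fix i j :: 3
  have "j \<in> {1, 2, 3}" using exhaust_3 by auto
  then show "lipschitz_near p (\<lambda>q. frame_matrix \<sigma> q $ i $ j)"
    by (auto simp: frame_matrix_def transpose_def lipschitz_near_nth[OF a] lipschitz_near_nth[OF b]
        lipschitz_near_nth[OF n])
qed

text \<open>The factor of the right-hand side that depends on the state alone; separating it from the velocity of
\<open>c\<close>, which is merely continuous in time, isolates what has to be Lipschitz.\<close>

definition ode_matrix :: "(real \<times> real \<Rightarrow> real^3) \<Rightarrow> real^3 \<Rightarrow> real^3^3" where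
  "ode_matrix \<sigma> y =
     block_diag (matrix_inv (mat 1 - (y $ 3) *\<^sub>R weingarten \<sigma> (y $ 1, y $ 2))) (- 1)
       ** matrix_inv (frame_matrix \<sigma> (y $ 1, y $ 2))"

lemma lipschitz_near_ode_matrix:
  assumes K: "closed K" "convex K" "interior K \<noteq> {}"
    and U: "open U" "\<sigma> ` U \<subseteq> frontier K" "C2_on U \<sigma>" "regular_on U \<sigma>"
    and inward: "\<And>p. p \<in> U \<Longrightarrow> points_into K (\<sigma> p) (unit_normal \<sigma> p)"
    and W: "L-lipschitz_on U (weingarten \<sigma>)" and y: "y \<in> state_space U"
  shows "lipschitz_near y (ode_matrix \<sigma>)"
proof -
  have p: "(y $ 1, y $ 2) \<in> U" and r: "0 < y $ 3" using y by (auto simp: state_space_def)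
  have proj: "lipschitz_near y (\<lambda>y. (y $ 1, y $ 2))"
    by (intro bounded_linear.lipschitz_near bounded_linear_Pair bounded_linear_vec_nth)
  have "lipschitz_near y (\<lambda>y. weingarten \<sigma> (y $ 1, y $ 2))"
    by (rule lipschitz_near_compose[OF proj]) (rule lipschitz_nearI[OF U(1) p W])
  then have "lipschitz_near y (\<lambda>y. mat 1 - (y $ 3) *\<^sub>R weingarten \<sigma> (y $ 1, y $ 2))"
    by (intro lipschitz_near_diff lipschitz_near_const bounded_bilinear.lipschitz_near[OF bounded_bilinear_scaleR]
        bounded_linear.lipschitz_near[OF bounded_linear_vec_nth])
  then have "lipschitz_near y (\<lambda>y. matrix_inv (mat 1 - (y $ 3) *\<^sub>R weingarten \<sigma> (y $ 1, y $ 2)))"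
    by (rule lipschitz_near_compose)
       (rule lipschitz_near_matrix_inv[OF invertible_one_minus_weingarten[OF K U inward p r]])
  moreover have "lipschitz_near y (\<lambda>y. frame_matrix \<sigma> (y $ 1, y $ 2))"
    by (rule lipschitz_near_compose[OF proj]) (rule lipschitz_near_frame_matrix[OF U(1,3,4) p])
  then have "lipschitz_near y (\<lambda>y. matrix_inv (frame_matrix \<sigma> (y $ 1, y $ 2)))"
    by (rule lipschitz_near_compose)
       (rule lipschitz_near_matrix_inv[OF invertible_frame_matrix[OF U(4) p]])
  ultimately show ?thesis
    unfolding ode_matrix_def[abs_def]
    by (intro bounded_bilinear.lipschitz_near[OF bounded_bilinear_matrix_matrix_mult] lipschitz_near_block_diag)
qed

lemma open_state_space:
  assumes "open U"
  shows "open (state_space U)"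
proof -
  have "open ((\<lambda>y :: real^3. (y $ 1, y $ 2)) -` U)"
    by (intro open_vimage assms continuous_intros)
  moreover have "open {y :: real^3. 0 < y $ 3}"
    by (intro open_Collect_less continuous_intros)
  moreover have "state_space U = (\<lambda>y. (y $ 1, y $ 2)) -` U \<inter> {y. 0 < y $ 3}"
    by (auto simp: state_space_def)
  ultimately show ?thesis by (simp add: open_Int)
qed

theorem corollary2:
  fixes K :: "(real^3) set"
    and U :: "(real \<times> real) set"
    and \<sigma> :: "real \<times> real \<Rightarrow> real^3"
    and J :: "real set"
    and c :: "real \<Rightarrow> real^3"
  assumes "closed K" and "convex K" and "interior K \<noteq> {}"
    and "open U" and "\<sigma> ` U \<subseteq> frontier K"
    and "C2_on U \<sigma>" and "regular_on U \<sigma>"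
    and "\<And>p. p \<in> U \<Longrightarrow> points_into K (\<sigma> p) (unit_normal \<sigma> p)"
    and "open J" and "is_interval J"
    and "\<And>t. t \<in> J \<Longrightarrow> c t \<in> - K"
    and "\<exists>L. L-lipschitz_on U (weingarten \<sigma>)"
    and "c C1_differentiable_on J"
  shows "\<forall>t0\<in>J. \<forall>y0\<in>state_space U.
    \<exists>a b. a < t0 \<and> t0 < b \<and> {a<..<b} \<subseteq> J \<and>
      (\<exists>y. solves_on U \<sigma> c {a<..<b} y \<and> y t0 = y0 \<and>
        (\<forall>z. solves_on U \<sigma> c {a<..<b} z \<and> z t0 = y0 \<longrightarrow> (\<forall>t\<in>{a<..<b}. z t = y t)))"
proof (intro ballI)
  fix t0 y0 assume t0: "t0 \<in> J" and y0: "y0 \<in> state_space U"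
  obtain L where L: "L-lipschitz_on U (weingarten \<sigma>)" using assms(12) by blast
  have near: "lipschitz_near y (ode_matrix \<sigma>)" if "y \<in> state_space U" for y
    by (rule lipschitz_near_ode_matrix[OF assms(1-8) L that])
  have c': "continuous_on J (\<lambda>t. vector_derivative c (at t))"
    using assms(13) by (simp add: C1_differentiable_on_eq)
  have rhs: "ode_rhs \<sigma> c = (\<lambda>t y. ode_matrix \<sigma> y *v vector_derivative c (at t))"
    by (simp add: fun_eq_iff ode_rhs_def ode_matrix_def)
  have lip: "local_lipschitz J (state_space U) (ode_rhs \<sigma> c)"
    unfolding rhs by (rule local_lipschitz_matrix_forcing[OF near c'])
  have "continuous_on (J \<times> state_space U) (\<lambda>p. ode_matrix \<sigma> (snd p))"
    by (rule continuous_on_compose2[OF lipschitz_near_imp_continuous_on[OF near]])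
       (auto intro: continuous_on_snd continuous_on_id)
  moreover have "continuous_on (J \<times> state_space U) (\<lambda>p. vector_derivative c (at (fst p)))"
    by (rule continuous_on_compose2[OF c']) (auto intro: continuous_on_fst continuous_on_id)
  ultimately have "continuous_on (J \<times> state_space U)
      (\<lambda>p. ode_matrix \<sigma> (snd p) *v vector_derivative c (at (fst p)))"
    by (rule bounded_bilinear.continuous_on[OF bounded_bilinear_matrix_vector_mult])
  then have cont: "continuous_on (J \<times> state_space U) (\<lambda>(t, y). ode_rhs \<sigma> c t y)"
    by (simp add: rhs case_prod_unfold)
  obtain \<delta> y where \<delta>: "0 < \<delta>" "{t0 - \<delta><..<t0 + \<delta>} \<subseteq> J" "y t0 = y0"
    and y: "solves_on U \<sigma> c {t0 - \<delta><..<t0 + \<delta>} y"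
    using picard_lindelof_exists[OF assms(9) open_state_space[OF assms(4)] t0 y0 cont lip]
    unfolding solves_on_def by blast
  have unique: "z t = y t"
    if z: "solves_on U \<sigma> c {t0 - \<delta><..<t0 + \<delta>} z" "z t0 = y0" and t: "t \<in> {t0 - \<delta><..<t0 + \<delta>}" for z t
  proof (rule ode_solution_unique[OF lip _ _ \<delta>(2), where y = y and z = z and t = t and ?t0.0 = t0])
    show "y t0 = z t0" using \<delta>(3) z(2) by simp
  qed (use \<delta>(1) y z(1) t in \<open>auto simp only: solves_on_def open_greaterThanLessThan connected_Ioo
        greaterThanLessThan_iff\<close>)
  show "\<exists>a b. a < t0 \<and> t0 < b \<and> {a<..<b} \<subseteq> J \<and>
      (\<exists>y. solves_on U \<sigma> c {a<..<b} y \<and> y t0 = y0 \<and>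
        (\<forall>z. solves_on U \<sigma> c {a<..<b} z \<and> z t0 = y0 \<longrightarrow> (\<forall>t\<in>{a<..<b}. z t = y t)))"
  proof (rule exI[of _ "t0 - \<delta>"], rule exI[of _ "t0 + \<delta>"], intro conjI)
    show "t0 - \<delta> < t0" "t0 < t0 + \<delta>" using \<delta>(1) by simp_all
    show "\<exists>y. solves_on U \<sigma> c {t0 - \<delta><..<t0 + \<delta>} y \<and> y t0 = y0 \<and>
        (\<forall>z. solves_on U \<sigma> c {t0 - \<delta><..<t0 + \<delta>} z \<and> z t0 = y0 \<longrightarrow>
          (\<forall>t\<in>{t0 - \<delta><..<t0 + \<delta>}. z t = y t))"
      by (rule exI[of _ y]) (use y \<delta>(3) unique in blast)
  qed (rule \<delta>(2))
qed

end
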